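(* Let $P$ be a $p$-group of order $p^m$ and $T \cong \mathbb{Z}_p^d$ a $P$-module. For $n \geq 1$ and $r \geq 2m$, $$H^n(P,T/p^rT) = \mathrm{Image}(pro_r) \oplus \mathrm{Image}(inc_{r,m}),$$ with $\mathrm{Image}(pro_r) \cong H^n(P,T)$ and $\mathrm{Image}(inc_{r,m}) \cong H^{n+1}(P,T)$. Moreover this splitting is natural with respect to restriction to subgroups of $P$ and with respect to the action of $P$ on cohomology groups.
   Context: $\mathbb{Z}_p$ denotes the $p$-adic integers; modules are right modules written additively. $pro_r: H^n(P,T) \to H^n(P,T/p^rT)$ is induced by the projection $T \to T/p^rT$, and $inc_{r,m}: H^n(P, p^{r-m}T/p^rT) \to H^n(P,T/p^rT)$ is induced by the inclusion $p^{r-m}T/p^rT \to T/p^rT$. The action of $P$ on $H^n(P,M)$ is induced by $\gamma \mapsto \gamma^{g^{-1}}$, where $\gamma^g(g_1,\dots,g_n) = \gamma(g_1^g,\dots,g_n^g)^{g^{-1}}$. *)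

theory Defs
  imports "HOL-Algebra.Algebra"
begin

text \<open>Additive group of the p-adic integers, realised as the inverse limit of the
  groups Z/p^k Z: an element is a compatible sequence of residues x k in {0..<p^k}.\<close>
definition padic_group :: "nat \<Rightarrow> (nat \<Rightarrow> int) monoid" where
  "padic_group p =
     \<lparr>carrier = {x. \<forall>k. 0 \<le> x k \<and> x k < int p ^ k \<and> x (Suc k) mod int p ^ k = x k},
      monoid.mult = (\<lambda>x y. \<lambda>k. (x k + y k) mod int p ^ k),
      one = (\<lambda>k. 0)\<rparr>"

definition padic_vec_group :: "nat \<Rightarrow> nat \<Rightarrow> (nat \<Rightarrow> nat \<Rightarrow> int) monoid" where
  "padic_vec_group p d = product_group {..<d} (\<lambda>_. padic_group p)"

section \<open>Right P-modules (written multiplicatively in HOL-Algebra, i.e. additively in the paper)\<close>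

definition right_module ::
  "('g, 'x) monoid_scheme \<Rightarrow> ('a, 'y) monoid_scheme \<Rightarrow> ('a \<Rightarrow> 'g \<Rightarrow> 'a) \<Rightarrow> bool" where
  "right_module G M act \<longleftrightarrow> group G \<and> comm_group M \<and>
     (\<forall>g\<in>carrier G. \<forall>t\<in>carrier M. act t g \<in> carrier M) \<and>
     (\<forall>g\<in>carrier G. \<forall>s\<in>carrier M. \<forall>t\<in>carrier M. act (s \<otimes>\<^bsub>M\<^esub> t) g = act s g \<otimes>\<^bsub>M\<^esub> act t g) \<and>
     (\<forall>t\<in>carrier M. act t \<one>\<^bsub>G\<^esub> = t) \<and>
     (\<forall>g\<in>carrier G. \<forall>h\<in>carrier G. \<forall>t\<in>carrier M. act (act t g) h = act t (g \<otimes>\<^bsub>G\<^esub> h))"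

text \<open>Induced action on subsets (in particular on cosets, i.e. on quotient modules).\<close>
definition act_set :: "('a \<Rightarrow> 'g \<Rightarrow> 'a) \<Rightarrow> 'a set \<Rightarrow> 'g \<Rightarrow> 'a set" where
  "act_set act C g = (\<lambda>t. act t g) ` C"

definition tuples :: "('g, 'x) monoid_scheme \<Rightarrow> nat \<Rightarrow> 'g list set" where
  "tuples G n = {gs. length gs = n \<and> set gs \<subseteq> carrier G}"

definition cochain_group ::
  "('g, 'x) monoid_scheme \<Rightarrow> ('a, 'y) monoid_scheme \<Rightarrow> nat \<Rightarrow> ('g list \<Rightarrow> 'a) monoid" where
  "cochain_group G M n = product_group (tuples G n) (\<lambda>_. M)"

definition merge :: "('g, 'x) monoid_scheme \<Rightarrow> nat \<Rightarrow> 'g list \<Rightarrow> 'g list" where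
  "merge G i gs = take i gs @ [gs ! i \<otimes>\<^bsub>G\<^esub> gs ! Suc i] @ drop (Suc (Suc i)) gs"

definition cobound ::
  "('g, 'x) monoid_scheme \<Rightarrow> ('a, 'y) monoid_scheme \<Rightarrow> ('a \<Rightarrow> 'g \<Rightarrow> 'a) \<Rightarrow> nat
     \<Rightarrow> ('g list \<Rightarrow> 'a) \<Rightarrow> ('g list \<Rightarrow> 'a)" where
  "cobound G M act n f = (\<lambda>gs\<in>tuples G (Suc n).
      f (tl gs)
      \<otimes>\<^bsub>M\<^esub> finprod M (\<lambda>i. f (merge G i gs) [^]\<^bsub>M\<^esub> ((-1::int) ^ Suc i)) {..<n}
      \<otimes>\<^bsub>M\<^esub> (act (f (butlast gs)) (last gs)) [^]\<^bsub>M\<^esub> ((-1::int) ^ Suc n))"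

definition cocycles ::
  "('g, 'x) monoid_scheme \<Rightarrow> ('a, 'y) monoid_scheme \<Rightarrow> ('a \<Rightarrow> 'g \<Rightarrow> 'a) \<Rightarrow> nat \<Rightarrow> ('g list \<Rightarrow> 'a) set" where
  "cocycles G M act n = kernel (cochain_group G M n) (cochain_group G M (Suc n)) (cobound G M act n)"

fun coboundaries ::
  "('g, 'x) monoid_scheme \<Rightarrow> ('a, 'y) monoid_scheme \<Rightarrow> ('a \<Rightarrow> 'g \<Rightarrow> 'a) \<Rightarrow> nat \<Rightarrow> ('g list \<Rightarrow> 'a) set" where
  "coboundaries G M act 0 = {\<one>\<^bsub>cochain_group G M 0\<^esub>}"
| "coboundaries G M act (Suc n) = cobound G M act n ` carrier (cochain_group G M n)"

definition coh ::
  "('g, 'x) monoid_scheme \<Rightarrow> ('a, 'y) monoid_scheme \<Rightarrow> ('a \<Rightarrow> 'g \<Rightarrow> 'a) \<Rightarrow> nat \<Rightarrow> ('g list \<Rightarrow> 'a) set monoid" where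
  "coh G M act n =
     (cochain_group G M n)\<lparr>carrier := cocycles G M act n\<rparr> Mod coboundaries G M act n"

definition coh_class ::
  "('g, 'x) monoid_scheme \<Rightarrow> ('a, 'y) monoid_scheme \<Rightarrow> ('a \<Rightarrow> 'g \<Rightarrow> 'a) \<Rightarrow> nat
     \<Rightarrow> ('g list \<Rightarrow> 'a) \<Rightarrow> ('g list \<Rightarrow> 'a) set" where
  "coh_class G M act n f = coboundaries G M act n #>\<^bsub>cochain_group G M n\<^esub> f"

definition coh_map ::
  "('g, 'x) monoid_scheme \<Rightarrow> ('b, 'z) monoid_scheme \<Rightarrow> ('b \<Rightarrow> 'g \<Rightarrow> 'b) \<Rightarrow> nat
     \<Rightarrow> ('a \<Rightarrow> 'b) \<Rightarrow> ('g list \<Rightarrow> 'a) set \<Rightarrow> ('g list \<Rightarrow> 'b) set" where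
  "coh_map G M' act' n f C =
     coh_class G M' act' n (\<lambda>gs\<in>tuples G n. f ((SOME c. c \<in> C) gs))"

definition coh_res ::
  "('g, 'x) monoid_scheme \<Rightarrow> 'g set \<Rightarrow> ('a, 'y) monoid_scheme \<Rightarrow> ('a \<Rightarrow> 'g \<Rightarrow> 'a) \<Rightarrow> nat
     \<Rightarrow> ('g list \<Rightarrow> 'a) set \<Rightarrow> ('g list \<Rightarrow> 'a) set" where
  "coh_res G Q M act n C =
     coh_class (G\<lparr>carrier := Q\<rparr>) M act n (\<lambda>gs\<in>tuples (G\<lparr>carrier := Q\<rparr>) n. (SOME c. c \<in> C) gs)"

definition conj_cochain ::
  "('g, 'x) monoid_scheme \<Rightarrow> ('a \<Rightarrow> 'g \<Rightarrow> 'a) \<Rightarrow> nat \<Rightarrow> 'g \<Rightarrow> ('g list \<Rightarrow> 'a) \<Rightarrow> ('g list \<Rightarrow> 'a)" where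
  "conj_cochain G act n h f =
     (\<lambda>gs\<in>tuples G n. act (f (map (\<lambda>x. inv\<^bsub>G\<^esub> h \<otimes>\<^bsub>G\<^esub> x \<otimes>\<^bsub>G\<^esub> h) gs)) (inv\<^bsub>G\<^esub> h))"

definition coh_act ::
  "('g, 'x) monoid_scheme \<Rightarrow> ('a, 'y) monoid_scheme \<Rightarrow> ('a \<Rightarrow> 'g \<Rightarrow> 'a) \<Rightarrow> nat
     \<Rightarrow> 'g \<Rightarrow> ('g list \<Rightarrow> 'a) set \<Rightarrow> ('g list \<Rightarrow> 'a) set" where
  "coh_act G M act n g C =
     coh_class G M act n (conj_cochain G act n (inv\<^bsub>G\<^esub> g) (SOME c. c \<in> C))"

definition pT :: "nat \<Rightarrow> ('a, 'y) monoid_scheme \<Rightarrow> nat \<Rightarrow> 'a set" where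
  "pT p T r = {t [^]\<^bsub>T\<^esub> (p ^ r) | t. t \<in> carrier T}"

definition quot_mod :: "nat \<Rightarrow> ('a, 'y) monoid_scheme \<Rightarrow> nat \<Rightarrow> 'a set monoid" where
  "quot_mod p T r = T Mod pT p T r"

definition sub_mod :: "nat \<Rightarrow> ('a, 'y) monoid_scheme \<Rightarrow> nat \<Rightarrow> nat \<Rightarrow> 'a set monoid" where
  "sub_mod p T r m =
     (quot_mod p T r)\<lparr>carrier := (\<lambda>t. pT p T r #>\<^bsub>T\<^esub> t) ` pT p T (r - m)\<rparr>"

definition pro ::
  "('g, 'x) monoid_scheme \<Rightarrow> nat \<Rightarrow> ('a, 'y) monoid_scheme \<Rightarrow> ('a \<Rightarrow> 'g \<Rightarrow> 'a) \<Rightarrow> nat \<Rightarrow> nat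
     \<Rightarrow> ('g list \<Rightarrow> 'a) set \<Rightarrow> ('g list \<Rightarrow> 'a set) set" where
  "pro G p T act r n =
     coh_map G (quot_mod p T r) (act_set act) n (\<lambda>t. pT p T r #>\<^bsub>T\<^esub> t)"

definition inc ::
  "('g, 'x) monoid_scheme \<Rightarrow> nat \<Rightarrow> ('a, 'y) monoid_scheme \<Rightarrow> ('a \<Rightarrow> 'g \<Rightarrow> 'a) \<Rightarrow> nat \<Rightarrow> nat \<Rightarrow> nat
     \<Rightarrow> ('g list \<Rightarrow> 'a set) set \<Rightarrow> ('g list \<Rightarrow> 'a set) set" where
  "inc G p T act r m n = coh_map G (quot_mod p T r) (act_set act) n (\<lambda>C. C)"

definition pro_image where
  "pro_image G p T act r n = pro G p T act r n ` carrier (coh G T act n)"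

definition inc_image where
  "inc_image G p T act r m n =
     inc G p T act r m n ` carrier (coh G (sub_mod p T r m) (act_set act) n)"

definition coh_quot where
  "coh_quot G p T act r n = coh G (quot_mod p T r) (act_set act) n"

definition internal_direct_sum :: "('a, 'y) monoid_scheme \<Rightarrow> 'a set \<Rightarrow> 'a set \<Rightarrow> bool" where
  "internal_direct_sum H A B \<longleftrightarrow> subgroup A H \<and> subgroup B H \<and>
     A \<inter> B = {\<one>\<^bsub>H\<^esub>} \<and> A <#>\<^bsub>H\<^esub> B = carrier H"

end

theory Submission
  imports Defs
begin

text \<open>Multiplication by \<open>p\<^sup>r\<close> on the torsion-free module \<open>T\<close> has cokernel \<open>T/p\<^sup>rT\<close> and induces zero on
  \<open>H\<^sup>n(P,T)\<close> for \<open>n \<ge> 1\<close>, because \<open>|P|\<close> annihilates cohomology. So the long exact sequence breaks up into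
  \<open>0 \<rightarrow> H\<^sup>n(P,T) \<rightarrow> H\<^sup>n(P,T/p\<^sup>rT) \<rightarrow> H\<^sup>n\<^sup>+\<^sup>1(P,T) \<rightarrow> 0\<close>, whose second map, the connecting homomorphism, sends
  the class of \<open>f mod p\<^sup>r\<close> to the class of \<open>e\<close> with \<open>df = p\<^sup>r e\<close>. The image of \<open>inc\<close> is a complement of
  the kernel: if \<open>e\<close> is a cocycle then \<open>p\<^sup>m e = dc\<close> and \<open>p\<^sup>r\<^sup>-\<^sup>m c\<close> is a preimage of \<open>e\<close>; conversely, if
  \<open>p\<^sup>r\<^sup>-\<^sup>m c\<close> maps to a coboundary \<open>db\<close>, then \<open>c - p\<^sup>m b\<close> is a cocycle, which \<open>p\<^sup>r\<^sup>-\<^sup>m\<close> annihilates in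
  cohomology since \<open>r - m \<ge> m\<close>. Restriction and conjugation are both instances of pulling back
  cochains along a compatible pair of maps of groups and modules, with which the two maps of the
  exact sequence commute. The \<open>p\<close>-adic structure of \<open>T\<close> only enters through torsion-freeness.\<close>

section \<open>Powers and products in abelian groups\<close>

text \<open>Infinite index sets are covered as well: both products are then the neutral element by
  convention, and \<open>h\<close> preserves it.\<close>

lemma hom_finprod_comm_group:
  assumes "comm_group M" "comm_group N" "h \<in> hom M N" "f \<in> A \<rightarrow> carrier M"
  shows "h (finprod M f A) = finprod N (\<lambda>x. h (f x)) A"
proof -
  interpret M: comm_group M by fact
  interpret N: comm_group N by fact
  have h1: "h \<one>\<^bsub>M\<^esub> = \<one>\<^bsub>N\<^esub>"
    using assms(3) hom_one M.is_group N.is_group by blast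
  have hc: "h x \<in> carrier N" if "x \<in> carrier M" for x
    using hom_in_carrier[OF assms(3) that] .
  show ?thesis
    using assms(4)
  proof (induction A rule: infinite_finite_induct)
    case (insert x F)
    then show ?case
      using hom_mult[OF assms(3)] hc by (simp add: Pi_iff)
  qed (simp_all add: h1)
qed

lemma (in group) int_pow_minus_one_power:
  assumes "x \<in> carrier G"
  shows "x [^] ((-1::int) ^ j) = (if even j then x else inv x)"
  using assms int_pow_neg[of x 1] by (cases "even j") auto

lemma (in comm_group) finprod_inv:
  assumes "f \<in> A \<rightarrow> carrier G"
  shows "finprod G (\<lambda>x. inv (f x)) A = inv (finprod G f A)"
proof -
  have "(\<lambda>x. inv x) \<in> hom G G"
    by (auto simp: hom_def inv_mult)
  then show ?thesis
    using hom_finprod_comm_group[OF comm_group_axioms comm_group_axioms _ assms] by simp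
qed

lemma (in comm_group) mult_diff_cancel:
  "\<lbrakk>x \<in> carrier G; y \<in> carrier G\<rbrakk> \<Longrightarrow> x \<otimes> (y \<otimes> inv x) = y"
  using m_lcomm[of x y "inv x"] by simp

lemma (in comm_monoid) finprod_swap:
  assumes "finite A" "finite B" "\<And>x y. x \<in> A \<Longrightarrow> y \<in> B \<Longrightarrow> f x y \<in> carrier G"
  shows "(\<Otimes>x\<in>A. \<Otimes>y\<in>B. f x y) = (\<Otimes>y\<in>B. \<Otimes>x\<in>A. f x y)"
  using assms(1,3)
proof (induction A rule: finite_induct)
  case (insert a A)
  have "(\<Otimes>x\<in>insert a A. \<Otimes>y\<in>B. f x y) = (\<Otimes>y\<in>B. f a y) \<otimes> (\<Otimes>x\<in>A. \<Otimes>y\<in>B. f x y)"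
    using insert by (intro finprod_insert) (auto intro!: finprod_closed)
  also have "\<dots> = (\<Otimes>y\<in>B. f a y) \<otimes> (\<Otimes>y\<in>B. \<Otimes>x\<in>A. f x y)"
    using insert by simp
  also have "\<dots> = (\<Otimes>y\<in>B. f a y \<otimes> (\<Otimes>x\<in>A. f x y))"
    using insert by (intro finprod_multf[symmetric]) (auto intro!: finprod_closed)
  also have "\<dots> = (\<Otimes>y\<in>B. \<Otimes>x\<in>insert a A. f x y)"
    using insert by (intro finprod_cong') (auto intro!: finprod_closed)
  finally show ?case .
qed simp

text \<open>The cancellation pattern behind \<open>d d = 0\<close>: matching \<open>(j, i)\<close>
  with \<open>(i, j - 1)\<close> for \<open>i < j\<close> exhausts all index pairs. The induction
  step splits off the row \<open>j = N + 2\<close> and the column \<open>i = N + 1\<close>, which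
  cancel each other.\<close>

lemma (in comm_group) finprod_alternating_cancel:
  assumes "\<And>j i. j \<le> Suc N \<Longrightarrow> i \<le> N \<Longrightarrow> t j i \<in> carrier G"
    and "\<And>j i. i < j \<Longrightarrow> j \<le> Suc N \<Longrightarrow> t j i \<otimes> t i (j - 1) = \<one>"
  shows "(\<Otimes>j\<in>{..Suc N}. \<Otimes>i\<in>{..N}. t j i) = \<one>"
  using assms
proof (induction N)
  case 0
  have "finprod G (\<lambda>i. t j i) {..0} = t j 0" if "j \<le> 1" for j
    using 0(1)[of j 0] that by simp
  then have "(\<Otimes>j\<in>{..Suc 0}. \<Otimes>i\<in>{..0}. t j i) = (\<Otimes>j\<in>{..Suc 0}. t j 0)"
    using 0(1) by (intro finprod_cong') auto
  also have "\<dots> = t 1 0 \<otimes> t 0 0"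
    using 0(1) by (subst finprod_Suc) auto
  finally show ?case
    using 0(2)[of 0 1] by simp
next
  case (Suc N)
  let ?R = "\<lambda>j. \<Otimes>i\<in>{..Suc N}. t j i" and ?S = "\<lambda>j. \<Otimes>i\<in>{..N}. t j i"
  have cl: "?S j \<in> carrier G" if "j \<le> Suc (Suc N)" for j
    using Suc.prems(1) that by (intro finprod_closed) auto
  have cl': "?R j \<in> carrier G" if "j \<le> Suc (Suc N)" for j
    using Suc.prems(1) that by (intro finprod_closed) auto
  have "(\<Otimes>j\<in>{..Suc (Suc N)}. ?R j) = ?R (Suc (Suc N)) \<otimes> (\<Otimes>j\<in>{..Suc N}. ?R j)"
    using cl' by (intro finprod_Suc) auto
  also have "(\<Otimes>j\<in>{..Suc N}. ?R j) = (\<Otimes>j\<in>{..Suc N}. t j (Suc N) \<otimes> ?S j)"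
    using Suc.prems(1) cl by (intro finprod_cong' finprod_Suc) auto
  also have "\<dots> = (\<Otimes>j\<in>{..Suc N}. t j (Suc N)) \<otimes> (\<Otimes>j\<in>{..Suc N}. ?S j)"
    using Suc.prems(1) cl by (intro finprod_multf) auto
  also have "(\<Otimes>j\<in>{..Suc N}. ?S j) = \<one>"
    using Suc.prems by (intro Suc.IH) auto
  also have "(\<Otimes>j\<in>{..Suc N}. t j (Suc N)) \<otimes> \<one> = (\<Otimes>j\<in>{..Suc N}. t j (Suc N))"
    using Suc.prems(1) by (intro r_one finprod_closed) auto
  also have "?R (Suc (Suc N)) \<otimes> \<dots> = (\<Otimes>i\<in>{..Suc N}. t (Suc (Suc N)) i \<otimes> t i (Suc N))"
    using Suc.prems(1) by (intro finprod_multf[symmetric]) auto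
  also have "\<dots> = \<one>"
    using Suc.prems(2)[of _ "Suc (Suc N)"] by (intro finprod_one_eqI) auto
  finally show ?case .
qed

section \<open>Faces of tuples\<close>

text \<open>The faces of the bar construction except the one that deletes the last entry. Recursion
  along the list, in contrast to the slices in \<open>merge\<close>, makes the simplicial identity
  accessible to induction; the last equation only fills in lists that are too short.\<close>

fun face :: "('g, 'x) monoid_scheme \<Rightarrow> nat \<Rightarrow> 'g list \<Rightarrow> 'g list" where
  "face G 0 xs = tl xs"
| "face G (Suc 0) (x # y # zs) = (x \<otimes>\<^bsub>G\<^esub> y) # zs"
| "face G (Suc (Suc j)) (x # xs) = x # face G (Suc j) xs"
| "face G (Suc j) xs = xs"

lemma length_face: "j < length L \<Longrightarrow> length (face G j L) = length L - 1"
  by (induction G j L rule: face.induct) auto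

lemma (in monoid) set_face:
  assumes "j < length L" "set L \<subseteq> carrier G"
  shows "set (face G j L) \<subseteq> carrier G"
proof -
  \<comment> \<open>\<open>face.induct\<close> quantifies over the group as well, while the locale
    fixes it; hence the variable \<open>H\<close> that is equal to \<open>G\<close>.\<close>
  have "set (face H j L) \<subseteq> carrier G" if "H = G" for H :: "('a, 'b) monoid_scheme"
    using assms that
  proof (induction H j L rule: face.induct)
    case (1 H xs)
    then show ?case by (cases xs) auto
  qed auto
  then show ?thesis by simp
qed

text \<open>The simplicial identity. The two products overlap only for \<open>i = 1\<close> and
  \<open>j = 2\<close>, which is associativity; when both faces avoid the head of the list,
  induction on the tail applies.\<close>

lemma (in monoid) face_face:
  assumes "i < j" "j < length L" "set L \<subseteq> carrier G"
  shows "face G i (face G j L) = face G (j - 1) (face G i L)"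
  using assms
proof (induction L arbitrary: i j)
  case (Cons x xs)
  from Cons.prems obtain y zs where xs: "xs = y # zs" by (cases xs) auto
  obtain k where j: "j = Suc k" using Cons.prems by (cases j) auto
  consider "i = 0" | "i = 1" "k = 1" | k' where "i = 1" "k = Suc (Suc k')"
    | i' k' where "i = Suc (Suc i')" "k = Suc k'" "i' < k'"
  proof (cases i)
    case i: (Suc a)
    then obtain k' where k: "k = Suc k'" using Cons.prems j by (cases k) auto
    show ?thesis
    proof (cases a)
      case 0
      then show ?thesis using i k that by (cases k') auto
    next
      case (Suc i')
      then show ?thesis using i k j that Cons.prems by auto
    qed
  qed (use that in simp)
  then show ?case
  proof cases
    case 1
    then show ?thesis using j xs by (cases k) auto
  next
    case 2
    then show ?thesis using Cons.prems j xs m_assoc by (cases zs) auto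
  next
    case 3
    then show ?thesis using Cons.prems j xs by auto
  next
    case 4
    have "face G (Suc i') (face G (Suc k') xs) = face G k' (face G (Suc i') xs)"
      using Cons.IH[of "Suc i'" "Suc k'"] Cons.prems j 4 by auto
    then show ?thesis using 4 j by (cases k') auto
  qed
qed simp

text \<open>Index 0 of \<open>face\<close> is taken by the deletion of the head, hence the shift by
  one against \<open>merge\<close>.\<close>

lemma merge_conv_face: "Suc i < length L \<Longrightarrow> merge G i L = face G (Suc i) L"
proof (induction i arbitrary: L)
  case 0
  then obtain x y zs where "L = x # y # zs" by (cases L; cases "tl L") auto
  then show ?case by (simp add: merge_def)
next
  case (Suc i)
  then obtain x L' where L: "L = x # L'" by (cases L) auto
  with Suc.IH[of L'] Suc.prems have "merge G i L' = face G (Suc i) L'" by simp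
  with L show ?case by (simp add: merge_def)
qed

lemma face_snoc: "Suc j < length xs \<Longrightarrow>
    face G (Suc j) (xs @ [h]) = face G (Suc j) xs @ [h]"
proof (induction j arbitrary: xs)
  case 0
  then obtain x y zs where "xs = x # y # zs" by (cases xs; cases "tl xs") auto
  then show ?case by simp
next
  case (Suc j)
  then show ?case by (cases xs) auto
qed

text \<open>In this face the former last entry is absorbed by the appended one. It is the source of
  the last term of the coboundary, in which \<open>act\<close> takes the place of a product.\<close>

lemma face_snoc_last: "xs \<noteq> [] \<Longrightarrow>
    face G (length xs) (xs @ [h]) = butlast xs @ [last xs \<otimes>\<^bsub>G\<^esub> h]"
proof (induction xs)
  case (Cons x xs)
  then show ?case by (cases xs) auto
qed simp

section \<open>Cochains of a right module\<close>

locale right_mod = G: group G + M: comm_group M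
  for G :: "('g, 'x) monoid_scheme" (structure) and M :: "('a, 'y) monoid_scheme" (structure) +
  fixes act :: "'a \<Rightarrow> 'g \<Rightarrow> 'a"
  assumes act_closed [simp, intro]:
      "\<lbrakk>g \<in> carrier G; t \<in> carrier M\<rbrakk> \<Longrightarrow> act t g \<in> carrier M"
    and act_mult: "\<lbrakk>g \<in> carrier G; s \<in> carrier M; t \<in> carrier M\<rbrakk>
      \<Longrightarrow> act (s \<otimes>\<^bsub>M\<^esub> t) g = act s g \<otimes>\<^bsub>M\<^esub> act t g"
    and act_id [simp]: "t \<in> carrier M \<Longrightarrow> act t \<one>\<^bsub>G\<^esub> = t"
    and act_act: "\<lbrakk>g \<in> carrier G; h \<in> carrier G; t \<in> carrier M\<rbrakk>
      \<Longrightarrow> act (act t g) h = act t (g \<otimes>\<^bsub>G\<^esub> h)"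

lemma right_mod_iff: "right_mod G M act \<longleftrightarrow> right_module G M act"
  unfolding right_mod_def right_mod_axioms_def right_module_def by blast

text \<open>A tuple with an extra last entry \<open>h\<close> stands for the translate by
  \<open>h\<close> of a generator of the bar resolution; this is the equivariant extension of
  \<open>f\<close> to such translates.\<close>

definition cochain_eval :: "('a \<Rightarrow> 'g \<Rightarrow> 'a) \<Rightarrow> ('g list \<Rightarrow> 'a) \<Rightarrow> 'g list \<Rightarrow> 'a" where
  "cochain_eval act f L = act (f (butlast L)) (last L)"

lemma cochain_eval_snoc [simp]: "cochain_eval act f (xs @ [h]) = act (f xs) h"
  by (simp add: cochain_eval_def)

lemma tuples_iff: "gs \<in> tuples G n \<longleftrightarrow> length gs = n \<and> set gs \<subseteq> carrier G"
  by (simp add: tuples_def)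

lemma (in monoid) face_tuples:
  assumes "L \<in> tuples G (Suc n)" "j \<le> n"
  shows "face G j L \<in> tuples G n"
  using assms set_face[of j L] by (simp add: tuples_iff length_face)

lemma snoc_tuples: "gs \<in> tuples G n \<Longrightarrow> h \<in> carrier G \<Longrightarrow> gs @ [h] \<in> tuples G (Suc n)"
  by (auto simp: tuples_iff)

lemma cochain_group_simps [simp]:
  "carrier (cochain_group G M n) = (\<Pi>\<^sub>E gs\<in>tuples G n. carrier M)"
  "\<one>\<^bsub>cochain_group G M n\<^esub> = (\<lambda>gs\<in>tuples G n. \<one>\<^bsub>M\<^esub>)"
  "f \<otimes>\<^bsub>cochain_group G M n\<^esub> f' = (\<lambda>gs\<in>tuples G n. f gs \<otimes>\<^bsub>M\<^esub> f' gs)"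
  by (simp_all add: cochain_group_def)

lemma comm_group_cochain_group:
  assumes "comm_group M"
  shows "comm_group (cochain_group G M n)"
proof -
  interpret M: comm_group M by fact
  interpret C: group "cochain_group G M n"
    unfolding cochain_group_def using M.is_group by simp
  show ?thesis
    by (rule C.group_comm_groupI) (auto simp: PiE_iff fun_eq_iff restrict_def M.m_comm)
qed

lemma cochain_pow:
  assumes "f \<in> carrier (cochain_group G M n)" "gs \<in> tuples G n"
  shows "(f [^]\<^bsub>cochain_group G M n\<^esub> (k::nat)) gs = f gs [^]\<^bsub>M\<^esub> k"
  using assms(2) by (induction k) auto

section \<open>The coboundary operator as an alternating sum of faces\<close>

context right_mod
begin

abbreviation C :: "nat \<Rightarrow> ('g list \<Rightarrow> 'a) monoid" where "C \<equiv> cochain_group G M"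
abbreviation d :: "nat \<Rightarrow> ('g list \<Rightarrow> 'a) \<Rightarrow> 'g list \<Rightarrow> 'a" where "d \<equiv> cobound G M act"

lemma comm_group_C: "comm_group (C n)"
  using comm_group_cochain_group M.comm_group_axioms .

lemma cochain_closed: "f \<in> carrier (C n) \<Longrightarrow> gs \<in> tuples G n \<Longrightarrow> f gs \<in> carrier M"
  by auto

lemma act_hom: "g \<in> carrier G \<Longrightarrow> (\<lambda>t. act t g) \<in> hom M M"
  by (auto simp: hom_def act_mult)

lemma act_inv: "g \<in> carrier G \<Longrightarrow> t \<in> carrier M \<Longrightarrow> act (inv\<^bsub>M\<^esub> t) g = inv\<^bsub>M\<^esub> act t g"
  using group_hom.hom_inv[OF group_hom.intro[OF M.is_group M.is_group], of "\<lambda>t. act t g" t] act_hom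
  by (simp add: group_hom_axioms_def)

lemma act_pow: "g \<in> carrier G \<Longrightarrow> t \<in> carrier M \<Longrightarrow> act (t [^]\<^bsub>M\<^esub> (k::nat)) g = act t g [^]\<^bsub>M\<^esub> k"
  using hom_nat_pow[OF act_hom] M.is_group by blast

lemma act_finprod:
  "g \<in> carrier G \<Longrightarrow> f \<in> A \<rightarrow> carrier M \<Longrightarrow> act (finprod M f A) g = finprod M (\<lambda>x. act (f x) g) A"
  using hom_finprod_comm_group[OF M.comm_group_axioms M.comm_group_axioms act_hom] .

lemma cochain_eval_closed:
  assumes "f \<in> carrier (C n)" "L \<in> tuples G (Suc n)"
  shows "cochain_eval act f L \<in> carrier M"
proof -
  have "L \<noteq> []" using assms(2) by (auto simp: tuples_iff)
  then obtain xs h where "L = xs @ [h]" by (metis rev_exhaust)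
  then show ?thesis using assms by (auto simp: tuples_iff PiE_iff)
qed

text \<open>Appending a last entry on which the cochain acts through the module turns the
  coboundary into an alternating sum over all faces, the exceptional last term included.\<close>

lemma cobound_conv_face:
  assumes f: "f \<in> carrier (C n)" and gs: "gs \<in> tuples G (Suc n)"
  shows "d n f gs = (\<Otimes>\<^bsub>M\<^esub>j\<in>{..Suc n}.
    cochain_eval act f (face G j (gs @ [\<one>\<^bsub>G\<^esub>])) [^]\<^bsub>M\<^esub> ((-1::int) ^ j))"
proof -
  let ?L = "gs @ [\<one>\<^bsub>G\<^esub>]"
  define t where "t j = cochain_eval act f (face G j ?L) [^]\<^bsub>M\<^esub> ((-1::int) ^ j)" for j
  have len: "length gs = Suc n" and sub: "set gs \<subseteq> carrier G" using gs by (auto simp: tuples_iff)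
  have ne: "gs \<noteq> []" using len by auto
  have tcl: "t j \<in> carrier M" if "j \<le> Suc n" for j
    unfolding t_def using that gs
    by (intro M.int_pow_closed cochain_eval_closed[OF f] G.face_tuples snoc_tuples) auto
  have t0: "t 0 = f (tl gs)"
    unfolding t_def using ne len sub cochain_closed[OF f, of "tl gs"]
    by (cases gs) (auto simp: tuples_iff)
  have tmid: "t (Suc i) = f (merge G i gs) [^]\<^bsub>M\<^esub> ((-1::int) ^ Suc i)" if "i < n" for i
  proof -
    have "merge G i gs \<in> tuples G n"
      using that len sub G.set_face[of "Suc i" gs]
      by (auto simp: merge_conv_face tuples_iff length_face)
    then have "f (merge G i gs) \<in> carrier M" using cochain_closed[OF f] by blast
    then show ?thesis
      unfolding t_def using that len by (simp add: face_snoc merge_conv_face)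
  qed
  have midcl: "f (merge G i gs) [^]\<^bsub>M\<^esub> ((-1::int) ^ Suc i) \<in> carrier M" if "i < n" for i
    using tcl[of "Suc i"] that unfolding tmid[OF that] by simp
  have bl: "butlast gs \<in> tuples G n" "last gs \<in> carrier G"
    using len sub ne by (auto simp: tuples_iff dest: in_set_butlastD)
  \<comment> \<open>The appended unit is multiplied onto the last entry of \<open>gs\<close>, which
    then acts through the module.\<close>
  then have tlast: "t (Suc n) = act (f (butlast gs)) (last gs) [^]\<^bsub>M\<^esub> ((-1::int) ^ Suc n)"
    unfolding t_def using face_snoc_last[OF ne, of G "\<one>\<^bsub>G\<^esub>"] len by simp
  have "(\<Otimes>\<^bsub>M\<^esub>j\<in>{..Suc n}. t j) = (\<Otimes>\<^bsub>M\<^esub>j\<in>{..n}. t (Suc j)) \<otimes>\<^bsub>M\<^esub> t 0"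
    using tcl by (intro M.finprod_Suc2) auto
  also have "{..n} = insert n {..<n}" by auto
  also have "(\<Otimes>\<^bsub>M\<^esub>j\<in>insert n {..<n}. t (Suc j)) = t (Suc n) \<otimes>\<^bsub>M\<^esub> (\<Otimes>\<^bsub>M\<^esub>j\<in>{..<n}. t (Suc j))"
    using tcl by (intro M.finprod_insert) auto
  also have "(\<Otimes>\<^bsub>M\<^esub>j\<in>{..<n}. t (Suc j))
      = (\<Otimes>\<^bsub>M\<^esub>i\<in>{..<n}. f (merge G i gs) [^]\<^bsub>M\<^esub> ((-1::int) ^ Suc i))"
    using tmid midcl by (intro M.finprod_cong') (auto simp del: power_Suc)
  finally have "(\<Otimes>\<^bsub>M\<^esub>j\<in>{..Suc n}. t j) = t (Suc n) \<otimes>\<^bsub>M\<^esub>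
      (\<Otimes>\<^bsub>M\<^esub>i\<in>{..<n}. f (merge G i gs) [^]\<^bsub>M\<^esub> ((-1::int) ^ Suc i)) \<otimes>\<^bsub>M\<^esub> t 0" .
  moreover have "(\<Otimes>\<^bsub>M\<^esub>i\<in>{..<n}. f (merge G i gs) [^]\<^bsub>M\<^esub> ((-1::int) ^ Suc i)) \<in> carrier M"
    using midcl by (intro M.finprod_closed) (auto simp del: power_Suc)
  ultimately have "(\<Otimes>\<^bsub>M\<^esub>j\<in>{..Suc n}. t j) = t 0 \<otimes>\<^bsub>M\<^esub>
      (\<Otimes>\<^bsub>M\<^esub>i\<in>{..<n}. f (merge G i gs) [^]\<^bsub>M\<^esub> ((-1::int) ^ Suc i)) \<otimes>\<^bsub>M\<^esub> t (Suc n)"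
    using tcl[of 0] tcl[of "Suc n"] by (simp add: M.m_ac)
  then show ?thesis
    using gs by (simp add: cobound_def t_def[symmetric] t0 tlast)
qed

lemma cobound_closed:
  assumes "f \<in> carrier (C n)"
  shows "d n f \<in> carrier (C (Suc n))"
proof -
  have "d n f gs \<in> carrier M" if "gs \<in> tuples G (Suc n)" for gs
    unfolding cobound_conv_face[OF assms that]
    using that by (auto intro!: M.finprod_closed M.int_pow_closed cochain_eval_closed[OF assms] G.face_tuples snoc_tuples)
  then show ?thesis by (auto simp: cobound_def)
qed

text \<open>Faces multiply onto the final entry only from the left, so a later action by
  \<open>h\<close> amounts to having \<open>h\<close> there in place of the unit. In the last face
  this is the associativity law of the action.\<close>

lemma act_cochain_eval_face:
  assumes f: "f \<in> carrier (C n)" and gs: "gs \<in> tuples G (Suc n)" and h: "h \<in> carrier G"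
    and j: "j \<le> Suc n"
  shows "act (cochain_eval act f (face G j (gs @ [\<one>\<^bsub>G\<^esub>]))) h = cochain_eval act f (face G j (gs @ [h]))"
proof -
  have len: "length gs = Suc n" and sub: "set gs \<subseteq> carrier G" using gs by (auto simp: tuples_iff)
  have ne: "gs \<noteq> []" using len by auto
  consider "j = 0" | i where "j = Suc i" "Suc i < length gs" | "j = length gs"
    using j len by (cases j) (auto simp: le_less)
  then show ?thesis
  proof cases
    case 1
    then show ?thesis using ne h len sub cochain_closed[OF f, of "tl gs"]
      by (cases gs) (auto simp: tuples_iff act_act)
  next
    case 2
    have "f (face G j gs) \<in> carrier M"
      using 2 G.face_tuples[OF gs, of j] len cochain_closed[OF f] by auto
    then show ?thesis using 2 h by (simp add: face_snoc)
  next
    case 3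
    have "butlast gs \<in> tuples G n" "last gs \<in> carrier G"
      using len sub ne by (auto simp: tuples_iff dest: in_set_butlastD)
    then show ?thesis using 3 h cochain_closed[OF f] face_snoc_last[OF ne, of G] by (auto simp: act_act)
  qed
qed

text \<open>The alternating sum for an arbitrary last entry. Both sides are of the form
  \<open>cochain_eval\<close>, so the formula can be iterated.\<close>

lemma cochain_eval_cobound:
  assumes f: "f \<in> carrier (C n)" and L: "L \<in> tuples G (Suc (Suc n))"
  shows "cochain_eval act (d n f) L =
    (\<Otimes>\<^bsub>M\<^esub>j\<in>{..Suc n}. cochain_eval act f (face G j L) [^]\<^bsub>M\<^esub> ((-1::int) ^ j))"
proof -
  have "L \<noteq> []" using L by (auto simp: tuples_iff)
  then obtain gs h where Lsnoc: "L = gs @ [h]" by (metis rev_exhaust)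
  with L have gs: "gs \<in> tuples G (Suc n)" and h: "h \<in> carrier G" by (auto simp: tuples_iff)
  have cl: "cochain_eval act f (face G j (gs @ [k])) \<in> carrier M" if "j \<le> Suc n" "k \<in> carrier G" for j k
    using that gs by (auto intro!: cochain_eval_closed[OF f] G.face_tuples snoc_tuples)
  have "cochain_eval act (d n f) L = (\<Otimes>\<^bsub>M\<^esub>j\<in>{..Suc n}.
      act (cochain_eval act f (face G j (gs @ [\<one>\<^bsub>G\<^esub>])) [^]\<^bsub>M\<^esub> ((-1::int) ^ j)) h)"
    unfolding Lsnoc cochain_eval_snoc cobound_conv_face[OF f gs]
    using cl h by (intro act_finprod) auto
  also have "\<dots> = (\<Otimes>\<^bsub>M\<^esub>j\<in>{..Suc n}. cochain_eval act f (face G j L) [^]\<^bsub>M\<^esub> ((-1::int) ^ j))"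
    using cl h by (intro M.finprod_cong')
      (auto simp: Lsnoc M.int_pow_minus_one_power act_inv act_cochain_eval_face[OF f gs h])
  finally show ?thesis .
qed

text \<open>By \<open>face_face\<close> the terms \<open>(j, i)\<close> and
  \<open>(i, j - 1)\<close> with \<open>i < j\<close> carry the same double face, and their sign
  exponents differ by one.\<close>

lemma cobound_cobound:
  assumes f: "f \<in> carrier (C n)"
  shows "d (Suc n) (d n f) = \<one>\<^bsub>C (Suc (Suc n))\<^esub>"
proof -
  have "d (Suc n) (d n f) gs = \<one>\<^bsub>M\<^esub>" if gs: "gs \<in> tuples G (Suc (Suc n))" for gs
  proof -
    let ?L = "gs @ [\<one>\<^bsub>G\<^esub>]"
    define t where "t j i = cochain_eval act f (face G i (face G j ?L)) [^]\<^bsub>M\<^esub> ((-1::int) ^ (i + j))" for i j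
    have L: "?L \<in> tuples G (Suc (Suc (Suc n)))" using snoc_tuples[OF gs] by simp
    have L': "length ?L = Suc (Suc (Suc n))" "set ?L \<subseteq> carrier G" using L by (auto simp: tuples_iff)
    have cl: "cochain_eval act f (face G i (face G j ?L)) \<in> carrier M" if "j \<le> Suc (Suc n)" "i \<le> Suc n" for i j
      using that L by (auto intro!: cochain_eval_closed[OF f] G.face_tuples)
    have "d (Suc n) (d n f) gs = (\<Otimes>\<^bsub>M\<^esub>j\<in>{..Suc (Suc n)}.
       (\<Otimes>\<^bsub>M\<^esub>i\<in>{..Suc n}. cochain_eval act f (face G i (face G j ?L)) [^]\<^bsub>M\<^esub> ((-1::int) ^ i)) [^]\<^bsub>M\<^esub> ((-1::int) ^ j))"
      unfolding cobound_conv_face[OF cobound_closed[OF f] gs]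
      using L cl by (intro M.finprod_cong') (auto simp: cochain_eval_cobound[OF f] G.face_tuples)
    also have "\<dots> = (\<Otimes>\<^bsub>M\<^esub>j\<in>{..Suc (Suc n)}. \<Otimes>\<^bsub>M\<^esub>i\<in>{..Suc n}. t j i)"
    proof (intro M.finprod_cong')
      fix j assume j: "j \<in> {..Suc (Suc n)}"
      have "(\<Otimes>\<^bsub>M\<^esub>i\<in>{..Suc n}. cochain_eval act f (face G i (face G j ?L)) [^]\<^bsub>M\<^esub> ((-1::int) ^ i)) [^]\<^bsub>M\<^esub> ((-1::int) ^ j)
        = (\<Otimes>\<^bsub>M\<^esub>i\<in>{..Suc n}. (cochain_eval act f (face G i (face G j ?L)) [^]\<^bsub>M\<^esub> ((-1::int) ^ i)) [^]\<^bsub>M\<^esub> ((-1::int) ^ j))"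
        using j cl
        by (intro hom_finprod_comm_group[OF M.comm_group_axioms M.comm_group_axioms])
           (auto simp: hom_def M.int_pow_distrib)
      also have "\<dots> = (\<Otimes>\<^bsub>M\<^esub>i\<in>{..Suc n}. t j i)"
        using j cl by (intro M.finprod_cong') (auto simp: t_def M.int_pow_pow power_add mult.commute)
      finally show "(\<Otimes>\<^bsub>M\<^esub>i\<in>{..Suc n}. cochain_eval act f (face G i (face G j ?L)) [^]\<^bsub>M\<^esub> ((-1::int) ^ i)) [^]\<^bsub>M\<^esub> ((-1::int) ^ j)
        = (\<Otimes>\<^bsub>M\<^esub>i\<in>{..Suc n}. t j i)" .
    qed (use cl in \<open>auto simp: t_def intro!: M.finprod_closed\<close>)
    also have "\<dots> = \<one>\<^bsub>M\<^esub>"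
    proof (rule M.finprod_alternating_cancel)
      show "t j i \<in> carrier M" if "j \<le> Suc (Suc n)" "i \<le> Suc n" for j i
        using cl that by (auto simp: t_def)
    next
      fix i j assume ij: "i < j" "j \<le> Suc (Suc n)"
      have "face G (j - 1) (face G i ?L) = face G i (face G j ?L)"
        using G.face_face[of i j ?L] ij L' by auto
      moreover obtain k where "j = Suc k" using ij by (cases j) auto
      ultimately show "t j i \<otimes>\<^bsub>M\<^esub> t i (j - 1) = \<one>\<^bsub>M\<^esub>"
        using ij cl[of j i] by (auto simp: t_def M.int_pow_minus_one_power M.int_pow_neg add.commute)
    qed
    finally show ?thesis .
  qed
  then show ?thesis by (auto simp: cobound_def[of _ _ _ "Suc n"] fun_eq_iff restrict_def)
qed

end

section \<open>The group order annihilates cohomology\<close>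

context right_mod
begin

text \<open>A homotopy between zero and multiplication by the order of the group in positive
  degrees: the first argument is summed out over the whole group.\<close>

definition sum_first :: "nat \<Rightarrow> ('g list \<Rightarrow> 'a) \<Rightarrow> 'g list \<Rightarrow> 'a" where
  "sum_first n f = (\<lambda>gs\<in>tuples G n. \<Otimes>\<^bsub>M\<^esub>x\<in>carrier G. f (x # gs))"

lemma Cons_tuples: "x \<in> carrier G \<Longrightarrow> gs \<in> tuples G n \<Longrightarrow> x # gs \<in> tuples G (Suc n)"
  by (auto simp: tuples_iff)

lemma sum_first_closed: "f \<in> carrier (C (Suc n)) \<Longrightarrow> sum_first n f \<in> carrier (C n)"
  by (auto simp: sum_first_def intro!: M.finprod_closed cochain_closed Cons_tuples)

lemma cochain_eval_sum_first:
  assumes f: "f \<in> carrier (C (Suc n))" and K: "K \<in> tuples G (Suc n)"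
  shows "cochain_eval act (sum_first n f) K = (\<Otimes>\<^bsub>M\<^esub>x\<in>carrier G. cochain_eval act f (x # K))"
proof -
  have "K \<noteq> []" using K by (auto simp: tuples_iff)
  then obtain ks h where Ksnoc: "K = ks @ [h]" by (metis rev_exhaust)
  with K have ks: "ks \<in> tuples G n" and h: "h \<in> carrier G" by (auto simp: tuples_iff)
  have "cochain_eval act (sum_first n f) K = (\<Otimes>\<^bsub>M\<^esub>x\<in>carrier G. act (f (x # ks)) h)"
    using ks h by (auto simp: Ksnoc sum_first_def intro!: act_finprod cochain_closed[OF f] Cons_tuples)
  moreover have "cochain_eval act f (x # K) = act (f (x # ks)) h" for x
    using cochain_eval_snoc[of act f "x # ks" h] by (simp add: Ksnoc)
  ultimately show ?thesis by simp
qed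

text \<open>A prefixed \<open>x\<close> shifts the index of every face by one. The only interaction
  is in face 1, which multiplies \<open>x\<close> by the first entry of \<open>L\<close>; reindexing
  the sum by this right translation removes the factor.\<close>

lemma cochain_eval_face_sum_first:
  assumes f: "f \<in> carrier (C (Suc n))" and L: "L \<in> tuples G (Suc (Suc n))" and j: "j \<le> Suc n"
  shows "cochain_eval act (sum_first n f) (face G j L) =
    (\<Otimes>\<^bsub>M\<^esub>x\<in>carrier G. cochain_eval act f (face G (Suc j) (x # L)))"
proof (cases j)
  case 0
  obtain y zs where Lc: "L = y # zs" using L by (cases L) (auto simp: tuples_iff)
  with L have y: "y \<in> carrier G" and zs: "zs \<in> tuples G (Suc n)" by (auto simp: tuples_iff)
  have inj: "inj_on (\<lambda>x. x \<otimes> y) (carrier G)" using G.inj_on_multc[OF y] .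
  have img: "(\<lambda>x. x \<otimes> y) ` carrier G = carrier G"
  proof (intro equalityI subsetI)
    fix z assume "z \<in> carrier G"
    then show "z \<in> (\<lambda>x. x \<otimes> y) ` carrier G"
      using y by (intro image_eqI[of _ _ "z \<otimes> inv y"]) (auto simp: G.m_assoc)
  qed (use y in auto)
  have "(\<Otimes>\<^bsub>M\<^esub>x\<in>carrier G. cochain_eval act f (face G (Suc j) (x # L)))
      = (\<Otimes>\<^bsub>M\<^esub>x\<in>carrier G. cochain_eval act f ((x \<otimes> y) # zs))"
    by (simp add: 0 Lc)
  also have "\<dots> = (\<Otimes>\<^bsub>M\<^esub>x\<in>carrier G. cochain_eval act f (x # zs))"
    using M.finprod_reindex[OF _ inj, of "\<lambda>x. cochain_eval act f (x # zs)"]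
      cochain_eval_closed[OF f Cons_tuples[OF _ zs]]
    by (simp add: img)
  also have "\<dots> = cochain_eval act (sum_first n f) (face G j L)"
    using cochain_eval_sum_first[OF f zs] by (simp add: 0 Lc)
  finally show ?thesis by simp
next
  case (Suc k)
  then show ?thesis
    using cochain_eval_sum_first[OF f G.face_tuples[OF L j]] by simp
qed

text \<open>Face 0 deletes \<open>x\<close> and contributes one copy of \<open>f gs\<close> for each
  group element. The remaining faces form the coboundary of \<open>sum_first n f\<close>, with all
  signs reversed because their indices are shifted by one.\<close>

lemma sum_cobound_first:
  assumes fin: "finite (carrier G)" and f: "f \<in> carrier (C (Suc n))" and gs: "gs \<in> tuples G (Suc n)"
  shows "(\<Otimes>\<^bsub>M\<^esub>x\<in>carrier G. d (Suc n) f (x # gs)) =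
    inv\<^bsub>M\<^esub> d n (sum_first n f) gs \<otimes>\<^bsub>M\<^esub> f gs [^]\<^bsub>M\<^esub> card (carrier G)"
proof -
  let ?L = "gs @ [\<one>\<^bsub>G\<^esub>]"
  define e where "e j x = cochain_eval act f (face G j (x # ?L))" for j x
  have L: "?L \<in> tuples G (Suc (Suc n))" using snoc_tuples[OF gs] by simp
  have ecl: "e j x \<in> carrier M" if "j \<le> Suc (Suc n)" "x \<in> carrier G" for j x
    unfolding e_def using that Cons_tuples[OF that(2) L]
    by (auto intro!: cochain_eval_closed[OF f] G.face_tuples)
  have e0: "e 0 x = f gs" for x
    using cochain_closed[OF f gs] by (simp add: e_def)
  define F where "F j = cochain_eval act (sum_first n f) (face G j ?L)" for j
  have Fcl: "F j \<in> carrier M" if "j \<le> Suc n" for j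
    unfolding F_def using that L
    by (auto intro!: cochain_eval_closed[OF sum_first_closed[OF f]] G.face_tuples)
  have "(\<Otimes>\<^bsub>M\<^esub>x\<in>carrier G. d (Suc n) f (x # gs)) = (\<Otimes>\<^bsub>M\<^esub>x\<in>carrier G.
      (\<Otimes>\<^bsub>M\<^esub>j\<in>{..Suc n}. e (Suc j) x [^]\<^bsub>M\<^esub> ((-1::int) ^ Suc j)) \<otimes>\<^bsub>M\<^esub> f gs)"
  proof (intro M.finprod_cong')
    fix x assume x: "x \<in> carrier G"
    have "d (Suc n) f (x # gs) = (\<Otimes>\<^bsub>M\<^esub>j\<in>{..Suc (Suc n)}. e j x [^]\<^bsub>M\<^esub> ((-1::int) ^ j))"
      using cobound_conv_face[OF f Cons_tuples[OF x gs]] by (simp add: e_def)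
    also have "\<dots> = (\<Otimes>\<^bsub>M\<^esub>j\<in>{..Suc n}. e (Suc j) x [^]\<^bsub>M\<^esub> ((-1::int) ^ Suc j))
        \<otimes>\<^bsub>M\<^esub> e 0 x [^]\<^bsub>M\<^esub> ((-1::int) ^ 0)"
      using ecl x by (intro M.finprod_Suc2) auto
    finally show "d (Suc n) f (x # gs) = (\<Otimes>\<^bsub>M\<^esub>j\<in>{..Suc n}. e (Suc j) x [^]\<^bsub>M\<^esub> ((-1::int) ^ Suc j)) \<otimes>\<^bsub>M\<^esub> f gs"
      using cochain_closed[OF f gs] by (simp add: e0)
  qed (use ecl cochain_closed[OF f gs] in \<open>auto intro!: M.finprod_closed\<close>)
  also have "\<dots> = (\<Otimes>\<^bsub>M\<^esub>x\<in>carrier G. \<Otimes>\<^bsub>M\<^esub>j\<in>{..Suc n}. e (Suc j) x [^]\<^bsub>M\<^esub> ((-1::int) ^ Suc j))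
      \<otimes>\<^bsub>M\<^esub> (\<Otimes>\<^bsub>M\<^esub>x\<in>carrier G. f gs)"
    using ecl cochain_closed[OF f gs] by (intro M.finprod_multf) (auto intro!: M.finprod_closed)
  also have "(\<Otimes>\<^bsub>M\<^esub>x\<in>carrier G. f gs) = f gs [^]\<^bsub>M\<^esub> card (carrier G)"
    using cochain_closed[OF f gs] by (intro M.finprod_const)
  also have "(\<Otimes>\<^bsub>M\<^esub>x\<in>carrier G. \<Otimes>\<^bsub>M\<^esub>j\<in>{..Suc n}. e (Suc j) x [^]\<^bsub>M\<^esub> ((-1::int) ^ Suc j))
      = (\<Otimes>\<^bsub>M\<^esub>j\<in>{..Suc n}. \<Otimes>\<^bsub>M\<^esub>x\<in>carrier G. e (Suc j) x [^]\<^bsub>M\<^esub> ((-1::int) ^ Suc j))"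
    using ecl fin by (intro M.finprod_swap) auto
  also have "\<dots> = (\<Otimes>\<^bsub>M\<^esub>j\<in>{..Suc n}. inv\<^bsub>M\<^esub> (F j [^]\<^bsub>M\<^esub> ((-1::int) ^ j)))"
  proof (intro M.finprod_cong')
    fix j assume j: "j \<in> {..Suc n}"
    have "F j = (\<Otimes>\<^bsub>M\<^esub>x\<in>carrier G. e (Suc j) x)"
      unfolding F_def e_def using cochain_eval_face_sum_first[OF f L] j by auto
    moreover have "(\<Otimes>\<^bsub>M\<^esub>x\<in>carrier G. e (Suc j) x) [^]\<^bsub>M\<^esub> ((-1::int) ^ Suc j)
       = (\<Otimes>\<^bsub>M\<^esub>x\<in>carrier G. e (Suc j) x [^]\<^bsub>M\<^esub> ((-1::int) ^ Suc j))"
      using j ecl by (intro hom_finprod_comm_group[OF M.comm_group_axioms M.comm_group_axioms])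
         (auto simp: hom_def M.int_pow_distrib)
    moreover have "F j [^]\<^bsub>M\<^esub> ((-1::int) ^ Suc j) = inv\<^bsub>M\<^esub> (F j [^]\<^bsub>M\<^esub> ((-1::int) ^ j))"
      using Fcl j by (simp add: M.int_pow_neg)
    ultimately show "(\<Otimes>\<^bsub>M\<^esub>x\<in>carrier G. e (Suc j) x [^]\<^bsub>M\<^esub> ((-1::int) ^ Suc j))
       = inv\<^bsub>M\<^esub> (F j [^]\<^bsub>M\<^esub> ((-1::int) ^ j))" by simp
  qed (use Fcl in auto)
  also have "\<dots> = inv\<^bsub>M\<^esub> (\<Otimes>\<^bsub>M\<^esub>j\<in>{..Suc n}. F j [^]\<^bsub>M\<^esub> ((-1::int) ^ j))"
    using Fcl by (intro M.finprod_inv) auto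
  also have "(\<Otimes>\<^bsub>M\<^esub>j\<in>{..Suc n}. F j [^]\<^bsub>M\<^esub> ((-1::int) ^ j)) = d n (sum_first n f) gs"
    unfolding F_def using cobound_conv_face[OF sum_first_closed[OF f] gs] by simp
  finally show ?thesis .
qed

text \<open>For a cocycle the left side of \<open>sum_cobound_first\<close> vanishes, so the
  homotopy displays the multiple as an explicit coboundary.\<close>

lemma pow_card_eq_cobound:
  assumes fin: "finite (carrier G)" and f: "f \<in> carrier (C (Suc n))"
    and df: "d (Suc n) f = \<one>\<^bsub>C (Suc (Suc n))\<^esub>"
  shows "f [^]\<^bsub>C (Suc n)\<^esub> card (carrier G) = d n (sum_first n f)"
proof -
  interpret CS: comm_group "C (Suc n)" by (rule comm_group_C)
  have "(f [^]\<^bsub>C (Suc n)\<^esub> card (carrier G)) gs = d n (sum_first n f) gs" if gs: "gs \<in> tuples G (Suc n)" for gs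
  proof -
    have cl: "d n (sum_first n f) gs \<in> carrier M" "f gs \<in> carrier M"
      using cochain_closed gs f sum_first_closed cobound_closed by blast+
    have "(\<Otimes>\<^bsub>M\<^esub>x\<in>carrier G. d (Suc n) f (x # gs)) = \<one>\<^bsub>M\<^esub>"
      by (intro M.finprod_one_eqI) (simp add: df Cons_tuples[OF _ gs])
    then have "f gs [^]\<^bsub>M\<^esub> card (carrier G) = d n (sum_first n f) gs"
      using sum_cobound_first[OF fin f gs] cl M.inv_equality M.inv_inv
      by (metis M.inv_closed M.nat_pow_closed M.inv_comm)
    then show ?thesis
      using cochain_pow[OF f gs] by simp
  qed
  moreover have "f [^]\<^bsub>C (Suc n)\<^esub> card (carrier G) \<in> carrier (C (Suc n))"
    using f CS.nat_pow_closed by blast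
  moreover have "d n (sum_first n f) \<in> carrier (C (Suc n))"
    using cobound_closed sum_first_closed f by blast
  ultimately show ?thesis
    unfolding cochain_group_simps by (metis PiE_ext)
qed

end

section \<open>Functoriality\<close>

lemma map_face:
  assumes "a \<in> hom G' G" "set L \<subseteq> carrier G'"
  shows "map a (face G' j L) = face G j (map a L)"
  using assms(2)
proof (induction L arbitrary: j)
  case Nil
  then show ?case by (cases j) auto
next
  case (Cons x xs)
  consider "j = 0" | "j = 1" | k where "j = Suc (Suc k)"
    by (cases j; cases "j - 1") auto
  then show ?case
  proof cases
    case 2
    then show ?thesis using Cons.prems hom_mult[OF assms(1)] by (cases xs) auto
  qed (use Cons in auto)
qed

text \<open>With the identity on groups this is a change of coefficients, with the identity on
  modules a restriction. Projection, inclusion, restriction and conjugation can therefore share one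
  set of lemmas.\<close>

definition pull :: "('h, 'x) monoid_scheme \<Rightarrow> nat \<Rightarrow> ('h \<Rightarrow> 'g) \<Rightarrow> ('a \<Rightarrow> 'b)
    \<Rightarrow> ('g list \<Rightarrow> 'a) \<Rightarrow> ('h list \<Rightarrow> 'b)" where
  "pull H n a \<beta> f = (\<lambda>gs\<in>tuples H n. \<beta> (f (map a gs)))"

locale compatible_pair =
  src: right_mod G M act + tgt: right_mod H N act'
  for G :: "('g, 'x) monoid_scheme" and M :: "('a, 'y) monoid_scheme" and act
    and H :: "('h, 'u) monoid_scheme" and N :: "('b, 'v) monoid_scheme" and act' +
  fixes a :: "'h \<Rightarrow> 'g" and \<beta> :: "'a \<Rightarrow> 'b"
  assumes group_map: "a \<in> hom H G"
    and module_map: "\<beta> \<in> hom M N"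
    and compatible: "\<lbrakk>h \<in> carrier H; t \<in> carrier M\<rbrakk> \<Longrightarrow> \<beta> (act t (a h)) = act' (\<beta> t) h"
begin

lemma map_tuples: "gs \<in> tuples H n \<Longrightarrow> map a gs \<in> tuples G n"
  using hom_in_carrier[OF group_map] by (auto simp: tuples_iff)

lemma pull_closed: "f \<in> carrier (src.C n) \<Longrightarrow> pull H n a \<beta> f \<in> carrier (tgt.C n)"
  using hom_in_carrier[OF module_map] src.cochain_closed map_tuples
  by (auto simp: pull_def)

lemma pull_hom: "pull H n a \<beta> \<in> hom (src.C n) (tgt.C n)"
proof (rule homI)
  fix f f' assume *: "f \<in> carrier (src.C n)" "f' \<in> carrier (src.C n)"
  then have "\<beta> (f (map a gs) \<otimes>\<^bsub>M\<^esub> f' (map a gs)) = \<beta> (f (map a gs)) \<otimes>\<^bsub>N\<^esub> \<beta> (f' (map a gs))"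
    if "gs \<in> tuples H n" for gs
    using map_tuples[OF that] src.cochain_closed by (intro hom_mult[OF module_map])
  then show "pull H n a \<beta> (f \<otimes>\<^bsub>src.C n\<^esub> f') = pull H n a \<beta> f \<otimes>\<^bsub>tgt.C n\<^esub> pull H n a \<beta> f'"
    by (auto simp: pull_def map_tuples fun_eq_iff)
qed (rule pull_closed)

lemma cochain_eval_pull:
  assumes f: "f \<in> carrier (src.C n)" and L: "L \<in> tuples H (Suc n)"
  shows "cochain_eval act' (pull H n a \<beta> f) L = \<beta> (cochain_eval act f (map a L))"
proof -
  have "L \<noteq> []" using L by (auto simp: tuples_iff)
  then obtain xs h where Lsnoc: "L = xs @ [h]" by (metis rev_exhaust)
  with L have xs: "xs \<in> tuples H n" and h: "h \<in> carrier H" by (auto simp: tuples_iff)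
  then show ?thesis
    using src.cochain_closed[OF f map_tuples[OF xs]]
    by (simp add: Lsnoc pull_def compatible)
qed

text \<open>Faces commute with \<open>map a\<close>, the module map commutes with alternating
  products, and compatibility handles the acting last entry; the appended unit is preserved because
  \<open>a\<close> is a homomorphism.\<close>

lemma cobound_pull:
  assumes f: "f \<in> carrier (src.C n)"
  shows "tgt.d n (pull H n a \<beta> f) = pull H (Suc n) a \<beta> (src.d n f)"
proof -
  have "tgt.d n (pull H n a \<beta> f) gs = \<beta> (src.d n f (map a gs))" if gs: "gs \<in> tuples H (Suc n)" for gs
  proof -
    have a1: "a \<one>\<^bsub>H\<^esub> = \<one>\<^bsub>G\<^esub>"
      using hom_one[OF group_map] by blast
    let ?L = "gs @ [\<one>\<^bsub>H\<^esub>]"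
    define e where "e j = cochain_eval act f (face G j (map a ?L))" for j
    have L: "?L \<in> tuples H (Suc (Suc n))" using snoc_tuples[OF gs] by simp
    have ecl: "e j \<in> carrier M" if "j \<le> Suc n" for j
      unfolding e_def using that map_tuples[OF L]
      by (intro src.cochain_eval_closed[OF f] src.G.face_tuples) auto
    have "tgt.d n (pull H n a \<beta> f) gs = (\<Otimes>\<^bsub>N\<^esub>j\<in>{..Suc n}. \<beta> (e j [^]\<^bsub>M\<^esub> ((-1::int) ^ j)))"
      unfolding tgt.cobound_conv_face[OF pull_closed[OF f] gs]
    proof (intro tgt.M.finprod_cong')
      fix j assume j: "j \<in> {..Suc n}"
      have "cochain_eval act' (pull H n a \<beta> f) (face H j ?L) = \<beta> (e j)"
        using j map_face[OF group_map, of ?L j] L cochain_eval_pull[OF f tgt.G.face_tuples[OF L]]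
        by (simp add: e_def tuples_iff)
      then show "cochain_eval act' (pull H n a \<beta> f) (face H j ?L) [^]\<^bsub>N\<^esub> ((-1::int) ^ j)
          = \<beta> (e j [^]\<^bsub>M\<^esub> ((-1::int) ^ j))"
        using hom_int_pow[OF module_map] ecl j by simp
    qed (use ecl hom_in_carrier[OF module_map] in auto)
    also have "\<dots> = \<beta> (\<Otimes>\<^bsub>M\<^esub>j\<in>{..Suc n}. e j [^]\<^bsub>M\<^esub> ((-1::int) ^ j))"
      using ecl by (intro hom_finprod_comm_group[symmetric, OF src.M.comm_group_axioms tgt.M.comm_group_axioms module_map]) auto
    also have "\<dots> = \<beta> (src.d n f (map a gs))"
      using src.cobound_conv_face[OF f map_tuples[OF gs]] by (simp add: e_def a1)
    finally show ?thesis .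
  qed
  then show ?thesis
    by (auto simp: pull_def cobound_def[of H] fun_eq_iff)
qed

end

section \<open>Cohomology classes\<close>

context right_mod
begin

abbreviation Z :: "nat \<Rightarrow> ('g list \<Rightarrow> 'a) set" where "Z \<equiv> cocycles G M act"
abbreviation B :: "nat \<Rightarrow> ('g list \<Rightarrow> 'a) set" where "B \<equiv> coboundaries G M act"
abbreviation cls :: "nat \<Rightarrow> ('g list \<Rightarrow> 'a) \<Rightarrow> ('g list \<Rightarrow> 'a) set" where "cls \<equiv> coh_class G M act"

lemma cobound_hom: "d n \<in> hom (C n) (C (Suc n))"
proof (rule homI)
  fix f f' assume *: "f \<in> carrier (C n)" "f' \<in> carrier (C n)"
  interpret CS: comm_group "C n" by (rule comm_group_C)
  have ff: "f \<otimes>\<^bsub>C n\<^esub> f' \<in> carrier (C n)" using * by (rule CS.m_closed)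
  have "d n (f \<otimes>\<^bsub>C n\<^esub> f') gs = d n f gs \<otimes>\<^bsub>M\<^esub> d n f' gs" if gs: "gs \<in> tuples G (Suc n)" for gs
  proof -
    have e: "cochain_eval act (f \<otimes>\<^bsub>C n\<^esub> f') L = cochain_eval act f L \<otimes>\<^bsub>M\<^esub> cochain_eval act f' L"
      if L: "L \<in> tuples G (Suc n)" for L
    proof -
      have "L \<noteq> []" using L by (auto simp: tuples_iff)
      then obtain xs h where Lsnoc: "L = xs @ [h]" by (metis rev_exhaust)
      with L have xs: "xs \<in> tuples G n" and h: "h \<in> carrier G" by (auto simp: tuples_iff)
      then show ?thesis
        using cochain_closed[OF *(1) xs] cochain_closed[OF *(2) xs] by (simp add: Lsnoc act_mult)
    qed
    have cl: "cochain_eval act f (face G j (gs @ [\<one>])) \<in> carrier M"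
      "cochain_eval act f' (face G j (gs @ [\<one>])) \<in> carrier M" if "j \<le> Suc n" for j
      using * that gs by (auto intro!: cochain_eval_closed G.face_tuples snoc_tuples)
    show ?thesis
      unfolding cobound_conv_face[OF ff gs] cobound_conv_face[OF *(1) gs] cobound_conv_face[OF *(2) gs]
    proof (subst M.finprod_multf[symmetric])
      show "(\<Otimes>\<^bsub>M\<^esub>j\<in>{..Suc n}. cochain_eval act (f \<otimes>\<^bsub>C n\<^esub> f') (face G j (gs @ [\<one>])) [^]\<^bsub>M\<^esub> ((-1::int) ^ j))
        = (\<Otimes>\<^bsub>M\<^esub>j\<in>{..Suc n}. cochain_eval act f (face G j (gs @ [\<one>])) [^]\<^bsub>M\<^esub> ((-1::int) ^ j)
            \<otimes>\<^bsub>M\<^esub> cochain_eval act f' (face G j (gs @ [\<one>])) [^]\<^bsub>M\<^esub> ((-1::int) ^ j))"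
        using cl e[OF G.face_tuples[OF snoc_tuples[OF gs G.one_closed]]]
        by (intro M.finprod_cong') (auto simp: M.int_pow_distrib simp del: cochain_group_simps)
    qed (use cl in auto)
  qed
  then show "d n (f \<otimes>\<^bsub>C n\<^esub> f') = d n f \<otimes>\<^bsub>C (Suc n)\<^esub> d n f'"
    by (auto simp: cobound_def fun_eq_iff)
qed (rule cobound_closed)

lemma group_hom_d: "group_hom (C n) (C (Suc n)) (d n)"
  using cobound_hom comm_group.axioms(2)[OF comm_group_C]
  by (simp add: group_hom_def group_hom_axioms_def)

lemma Z_iff: "f \<in> Z n \<longleftrightarrow> f \<in> carrier (C n) \<and> d n f = \<one>\<^bsub>C (Suc n)\<^esub>"
  by (simp add: cocycles_def kernel_def)

lemma subgroup_Z: "subgroup (Z n) (C n)"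
  unfolding cocycles_def using group_hom.subgroup_kernel[OF group_hom_d] .

lemma B_subset_Z: "B n \<subseteq> Z n"
proof (cases n)
  case 0
  then show ?thesis using subgroup.one_closed[OF subgroup_Z[of 0]] by auto
next
  case (Suc k)
  then show ?thesis using cobound_cobound cobound_closed by (auto simp: Z_iff simp del: cochain_group_simps)
qed

lemma subgroup_B: "subgroup (B n) (C n)"
proof (cases n)
  case 0
  then show ?thesis using group.triv_subgroup[OF comm_group.axioms(2)[OF comm_group_C[of 0]]] by simp
next
  case (Suc k)
  then show ?thesis using group_hom.img_is_subgroup[OF group_hom_d] by simp
qed

abbreviation Zg :: "nat \<Rightarrow> ('g list \<Rightarrow> 'a) monoid" where "Zg n \<equiv> (C n)\<lparr>carrier := Z n\<rparr>"

lemma comm_group_Zg: "comm_group (Zg n)"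
proof -
  interpret CS: comm_group "C n" by (rule comm_group_C)
  interpret Zs: group "Zg n" using CS.subgroup_imp_group[OF subgroup_Z] .
  have "Z n \<subseteq> carrier (C n)" using subgroup.subset[OF subgroup_Z] .
  then show ?thesis by (intro Zs.group_comm_groupI) (auto simp: CS.m_comm subset_iff simp del: cochain_group_simps)
qed

lemma normal_B: "B n \<lhd> Zg n"
proof -
  interpret CS: comm_group "C n" by (rule comm_group_C)
  interpret Zs: comm_group "Zg n" by (rule comm_group_Zg)
  show ?thesis
    using CS.subgroup_incl[OF subgroup_B subgroup_Z B_subset_Z] by (rule Zs.subgroup_imp_normal)
qed

text \<open>A coset depends only on the multiplication, so it is the same set in the group of
  cochains and in the group of cocycles. This gives access to the library facts on quotients of the
  latter.\<close>

lemma cls_conv: "cls n = (\<lambda>f. B n #>\<^bsub>Zg n\<^esub> f)"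
  by (simp add: coh_class_def r_coset_def fun_eq_iff)

lemma cls_hom: "cls n \<in> hom (Zg n) (coh G M act n)"
  unfolding cls_conv coh_def using normal.r_coset_hom_Mod[OF normal_B] .

lemma comm_group_coh: "comm_group (coh G M act n)"
  unfolding coh_def by (rule comm_group.abelian_FactGroup[OF comm_group_Zg normal_imp_subgroup[OF normal_B]])

lemma carrier_coh: "carrier (coh G M act n) = cls n ` Z n"
  by (simp add: coh_def carrier_FactGroup cls_conv)

lemma cls_mult: "\<lbrakk>f \<in> Z n; f' \<in> Z n\<rbrakk> \<Longrightarrow> cls n (f \<otimes>\<^bsub>C n\<^esub> f') = cls n f \<otimes>\<^bsub>coh G M act n\<^esub> cls n f'"
  using hom_mult[OF cls_hom] by simp

lemma cls_one_iff:
  assumes "f \<in> Z n"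
  shows "cls n f = \<one>\<^bsub>coh G M act n\<^esub> \<longleftrightarrow> f \<in> B n"
proof -
  interpret Zs: comm_group "Zg n" by (rule comm_group_Zg)
  have B: "subgroup (B n) (Zg n)" using normal_imp_subgroup[OF normal_B] .
  show ?thesis
    using Zs.coset_join1[OF _ _ B, of f] Zs.coset_join2[OF _ B, of f] assms
    unfolding cls_conv coh_def one_FactGroup by auto
qed

lemma cls_eq_iff:
  assumes "f \<in> Z n" "f' \<in> Z n"
  shows "cls n f = cls n f' \<longleftrightarrow> (\<exists>b\<in>B n. f = b \<otimes>\<^bsub>C n\<^esub> f')"
proof -
  interpret Zs: comm_group "Zg n" by (rule comm_group_Zg)
  have B: "subgroup (B n) (Zg n)" using normal_imp_subgroup[OF normal_B] .
  have f: "f \<in> carrier (Zg n)" "f' \<in> carrier (Zg n)" using assms by simp_all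
  have "cls n f = cls n f' \<longleftrightarrow> f \<in> B n #>\<^bsub>Zg n\<^esub> f'"
    unfolding cls_conv using Zs.repr_independence[OF _ f(2) B] Zs.rcos_self[OF f(1) B] by metis
  then show ?thesis by (simp add: r_coset_def)
qed

text \<open>\<open>coh_map\<close>, \<open>coh_res\<close> and \<open>coh_act\<close> pick a
  representative by Hilbert choice. The chosen one is again a cocycle of the same class.\<close>

lemma some_cls:
  assumes "f \<in> Z n"
  shows "(SOME c. c \<in> cls n f) \<in> Z n" "cls n (SOME c. c \<in> cls n f) = cls n f"
proof -
  interpret Zs: comm_group "Zg n" by (rule comm_group_Zg)
  have B: "subgroup (B n) (Zg n)" using normal_imp_subgroup[OF normal_B] .
  have "f \<in> cls n f" using Zs.rcos_self[OF _ B, of f] assms by (simp add: cls_conv)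
  then have *: "(SOME c. c \<in> cls n f) \<in> cls n f" by (metis someI)
  then show "(SOME c. c \<in> cls n f) \<in> Z n"
    using Zs.r_coset_subset_G[OF subgroup.subset[OF B], of f] assms by (auto simp: cls_conv)
  show "cls n (SOME c. c \<in> cls n f) = cls n f"
    using Zs.repr_independence[OF _ _ B, of _ f] * assms by (simp add: cls_conv)
qed

end

section \<open>Induced maps on cohomology classes\<close>

context compatible_pair
begin

lemma pull_one: "pull H n a \<beta> \<one>\<^bsub>src.C n\<^esub> = \<one>\<^bsub>tgt.C n\<^esub>"
  using comm_group.axioms(2)[OF src.comm_group_C] comm_group.axioms(2)[OF tgt.comm_group_C]
  by (rule hom_one[OF pull_hom])

lemma pull_Z:
  assumes "f \<in> src.Z n" shows "pull H n a \<beta> f \<in> tgt.Z n"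
  using assms pull_closed cobound_pull pull_one
  by (simp add: src.Z_iff tgt.Z_iff del: cochain_group_simps)

lemma pull_B:
  assumes "f \<in> src.B n" shows "pull H n a \<beta> f \<in> tgt.B n"
proof (cases n)
  case 0
  then show ?thesis using assms pull_one by (simp del: cochain_group_simps)
next
  case (Suc k)
  with assms obtain c where "c \<in> carrier (src.C k)" "f = src.d k c" by (auto simp del: cochain_group_simps)
  then have "pull H n a \<beta> f = tgt.d k (pull H k a \<beta> c)" "pull H k a \<beta> c \<in> carrier (tgt.C k)"
    using cobound_pull pull_closed Suc by auto
  then show ?thesis using Suc by simp
qed

lemma cls_pull_cong:
  assumes "f \<in> src.Z n" "f' \<in> src.Z n" "src.cls n f = src.cls n f'"
  shows "tgt.cls n (pull H n a \<beta> f) = tgt.cls n (pull H n a \<beta> f')"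
proof -
  obtain b where b: "b \<in> src.B n" "f = b \<otimes>\<^bsub>src.C n\<^esub> f'"
    using assms src.cls_eq_iff by blast
  have "b \<in> carrier (src.C n)" "f' \<in> carrier (src.C n)"
    using b assms subgroup.mem_carrier[OF src.subgroup_B] subgroup.mem_carrier[OF src.subgroup_Z] by blast+
  then have "pull H n a \<beta> f = pull H n a \<beta> b \<otimes>\<^bsub>tgt.C n\<^esub> pull H n a \<beta> f'"
    using b hom_mult[OF pull_hom] by blast
  then show ?thesis using pull_B[OF b(1)] assms pull_Z tgt.cls_eq_iff by blast
qed

text \<open>Well-definedness: a change of representative alters the pullback by the pullback of a
  coboundary, so any cocycle of the class may replace the chosen one.\<close>

lemma cls_pull_some:
  assumes "f \<in> src.Z n"
  shows "tgt.cls n (pull H n a \<beta> (SOME c. c \<in> src.cls n f)) = tgt.cls n (pull H n a \<beta> f)"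
  using cls_pull_cong src.some_cls assms by blast

end

declare cochain_group_simps [simp del]

section \<open>Submodules and quotient modules\<close>

context right_mod
begin

lemma right_mod_submodule:
  assumes N: "subgroup N M" and stable: "\<And>t g. t \<in> N \<Longrightarrow> g \<in> carrier G \<Longrightarrow> act t g \<in> N"
  shows "right_mod G (M\<lparr>carrier := N\<rparr>) act"
proof -
  interpret S: group "M\<lparr>carrier := N\<rparr>" using M.subgroup_imp_group[OF N] .
  have sub: "N \<subseteq> carrier M" using subgroup.subset[OF N] .
  then interpret S: comm_group "M\<lparr>carrier := N\<rparr>"
    by (intro S.group_comm_groupI) (auto simp: M.m_comm subset_iff)
  show ?thesis
    by unfold_locales (use sub stable in \<open>auto simp: subset_iff act_mult act_act\<close>)
qed

text \<open>\<open>act_set\<close> takes an image, so \<open>g\<close> has to map \<open>N\<close>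
  onto \<open>N\<close>. Surjectivity follows from stability under \<open>inv g\<close>.\<close>

lemma act_set_rcoset:
  assumes N: "subgroup N M" and stable: "\<And>t g. t \<in> N \<Longrightarrow> g \<in> carrier G \<Longrightarrow> act t g \<in> N"
    and t: "t \<in> carrier M" and g: "g \<in> carrier G"
  shows "act_set act (N #>\<^bsub>M\<^esub> t) g = N #>\<^bsub>M\<^esub> act t g"
proof -
  have sub: "N \<subseteq> carrier M" using subgroup.subset[OF N] .
  have "(\<lambda>x. act x g) ` N = N"
  proof (intro equalityI subsetI)
    fix x assume x: "x \<in> N"
    then show "x \<in> (\<lambda>x. act x g) ` N"
      using g sub stable[OF x, of "inv g"]
      by (intro image_eqI[of _ _ "act x (inv g)"]) (auto simp: act_act)
  qed (use g stable in auto)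
  then have *: "N #>\<^bsub>M\<^esub> act t g = ((\<lambda>x. act x g) ` N) #>\<^bsub>M\<^esub> act t g" by simp
  show ?thesis
    unfolding * using sub t g by (auto simp: act_set_def r_coset_def act_mult subset_iff image_iff)
qed

lemma right_mod_quotient:
  assumes N: "subgroup N M" and stable: "\<And>t g. t \<in> N \<Longrightarrow> g \<in> carrier G \<Longrightarrow> act t g \<in> N"
  shows "right_mod G (M Mod N) (act_set act)"
proof -
  interpret Q: comm_group "M Mod N" using M.abelian_FactGroup[OF N] .
  interpret N: normal N M using M.subgroup_imp_normal[OF N] .
  note [simp] = act_set_rcoset[OF N stable]
  show ?thesis
    by unfold_locales (auto simp: carrier_FactGroup N.rcos_sum act_mult act_act)
qed

lemma pow_hom: "(\<lambda>t. t [^]\<^bsub>M\<^esub> (k::nat)) \<in> hom M M"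
  by (auto simp: hom_def M.nat_pow_distrib)

lemma subgroup_pT: "subgroup (pT p M k) M"
proof -
  have "pT p M k = (\<lambda>t. t [^]\<^bsub>M\<^esub> (p ^ k)) ` carrier M" by (auto simp: pT_def)
  moreover have "group_hom M M (\<lambda>t. t [^]\<^bsub>M\<^esub> (p ^ k))"
    using pow_hom by (simp add: group_hom_def group_hom_axioms_def)
  ultimately show ?thesis using group_hom.img_is_subgroup by metis
qed

lemma act_pT: "t \<in> pT p M k \<Longrightarrow> g \<in> carrier G \<Longrightarrow> act t g \<in> pT p M k"
  by (auto simp: pT_def act_pow)

text \<open>Divisibility of cochains can be tested pointwise, since a root can be chosen separately
  for every tuple.\<close>

lemma cochain_in_pT:
  assumes "f \<in> carrier (C n)" "\<And>gs. gs \<in> tuples G n \<Longrightarrow> f gs \<in> pT p M k"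
  shows "\<exists>e\<in>carrier (C n). f = e [^]\<^bsub>C n\<^esub> (p ^ k)"
proof -
  interpret CS: comm_group "C n" by (rule comm_group_C)
  have "\<forall>gs\<in>tuples G n. \<exists>t\<in>carrier M. f gs = t [^]\<^bsub>M\<^esub> (p ^ k)"
    using assms(2) by (auto simp: pT_def)
  then obtain e where e: "\<And>gs. gs \<in> tuples G n \<Longrightarrow> e gs \<in> carrier M \<and> f gs = e gs [^]\<^bsub>M\<^esub> (p ^ k)"
    by metis
  let ?e = "\<lambda>gs\<in>tuples G n. e gs"
  have ec: "?e \<in> carrier (C n)" using e by (auto simp: cochain_group_simps)
  moreover have "f = ?e [^]\<^bsub>C n\<^esub> (p ^ k)"
  proof (rule PiE_ext)
    show "f \<in> (\<Pi>\<^sub>E gs\<in>tuples G n. carrier M)" using assms(1) by (simp add: cochain_group_simps)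
    show "?e [^]\<^bsub>C n\<^esub> (p ^ k) \<in> (\<Pi>\<^sub>E gs\<in>tuples G n. carrier M)"
      using CS.nat_pow_closed[OF ec] by (simp add: cochain_group_simps)
  qed (use e cochain_pow[OF ec] in simp)
  ultimately show ?thesis by blast
qed

end

section \<open>The connecting homomorphism\<close>

text \<open>The order only has to divide \<open>p ^ m\<close>, so that every subgroup of a group of
  order \<open>p ^ m\<close> satisfies the assumptions with the same \<open>m\<close>, hence with
  the same submodule \<open>sub_mod p T r m\<close>.\<close>

locale torsion_free_mod = right_mod G T act
  for G :: "('g, 'x) monoid_scheme" (structure) and T :: "('a, 'y) monoid_scheme" (structure) and act +
  fixes p r m :: nat
  assumes finite_G: "finite (carrier G)"
    and card_dvd: "card (carrier G) dvd p ^ m"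
    and two_m_le: "2 * m \<le> r"
    and torsion_free: "\<lbrakk>t \<in> carrier T; t [^]\<^bsub>T\<^esub> (p ^ r) = \<one>\<^bsub>T\<^esub>\<rbrakk> \<Longrightarrow> t = \<one>\<^bsub>T\<^esub>"
begin

abbreviation (input) \<pi> :: "'a \<Rightarrow> 'a set" where "\<pi> \<equiv> (\<lambda>t. pT p T r #>\<^bsub>T\<^esub> t)"

text \<open>The second equation exposes a factor \<open>p ^ m\<close> in \<open>p ^ (r - m)\<close>;
  this factor makes \<open>p ^ (r - m)\<close> annihilate cohomology of positive degree.\<close>

lemma pow_split: "p ^ r = p ^ m * p ^ (r - m)" "p ^ (r - m) = p ^ m * p ^ (r - 2 * m)"
  using two_m_le by (simp_all flip: power_add add: mult_2)

lemma pi_hom: "\<pi> \<in> hom T (quot_mod p T r)"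
  unfolding quot_mod_def using normal.r_coset_hom_Mod[OF M.subgroup_imp_normal[OF subgroup_pT]] .

lemma act_set_pi: "t \<in> carrier T \<Longrightarrow> g \<in> carrier G \<Longrightarrow> act_set act (\<pi> t) g = \<pi> (act t g)"
  using act_set_rcoset[OF subgroup_pT act_pT] .

sublocale Q: right_mod G "quot_mod p T r" "act_set act"
  unfolding quot_mod_def by (rule right_mod_quotient[OF subgroup_pT act_pT])

sublocale S: right_mod G "sub_mod p T r m" "act_set act"
  unfolding sub_mod_def
proof (rule Q.right_mod_submodule)
  have "group_hom T (quot_mod p T r) \<pi>"
    using pi_hom Q.M.is_group by (simp add: group_hom_def group_hom_axioms_def)
  then show "subgroup (\<pi> ` pT p T (r - m)) (quot_mod p T r)"
    using group_hom.subgroup_img_is_subgroup subgroup_pT by blast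
next
  fix t g assume "t \<in> \<pi> ` pT p T (r - m)" "g \<in> carrier G"
  then show "act_set act t g \<in> \<pi> ` pT p T (r - m)"
    using act_pT subgroup.mem_carrier[OF subgroup_pT] by (force simp: act_set_pi)
qed

sublocale pro: compatible_pair G T act G "quot_mod p T r" "act_set act" "\<lambda>x. x" \<pi>
  by unfold_locales (use pi_hom act_set_pi in \<open>auto simp: hom_def\<close>)

lemma carrier_sub_mod: "carrier (sub_mod p T r m) = \<pi> ` pT p T (r - m)"
  by (simp add: sub_mod_def)

lemma sub_mod_subset: "carrier (sub_mod p T r m) \<subseteq> carrier (quot_mod p T r)"
  using subgroup.mem_carrier[OF subgroup_pT] hom_in_carrier[OF pi_hom] by (auto simp: carrier_sub_mod)

sublocale inc: compatible_pair G "sub_mod p T r m" "act_set act" G "quot_mod p T r" "act_set act" "\<lambda>x. x" "\<lambda>x. x"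
  by unfold_locales (use sub_mod_subset in \<open>auto simp: hom_def sub_mod_def\<close>)

section \<open>Reduction of cochains modulo \<open>p ^ r\<close>\<close>

abbreviation Pi :: "nat \<Rightarrow> ('g list \<Rightarrow> 'a) \<Rightarrow> 'g list \<Rightarrow> 'a set" where
  "Pi n \<equiv> pull G n (\<lambda>x. x) \<pi>"

lemma Pi_apply: "gs \<in> tuples G n \<Longrightarrow> Pi n f gs = \<pi> (f gs)"
  by (simp add: pull_def)

lemma pull_inc: "h \<in> carrier (S.C n) \<Longrightarrow> pull G n (\<lambda>x. x) (\<lambda>x. x) h = h"
  by (auto simp: pull_def cochain_group_simps fun_eq_iff PiE_iff extensional_def)

text \<open>The inclusion of the submodule is the identity on elements, so the two coboundary
  operators agree on cochains with values in the submodule.\<close>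

lemma S_Z_iff: "h \<in> S.Z n \<longleftrightarrow> h \<in> carrier (S.C n) \<and> h \<in> Q.Z n"
proof -
  have "Q.d n h = S.d n h" if h: "h \<in> carrier (S.C n)"
    using inc.cobound_pull[OF h] pull_inc[OF h] pull_inc[OF S.cobound_closed[OF h]] by simp
  moreover have "h \<in> carrier (Q.C n)" if h: "h \<in> carrier (S.C n)"
    using inc.pull_closed[OF h] pull_inc[OF h] by simp
  moreover have "\<one>\<^bsub>S.C (Suc n)\<^esub> = \<one>\<^bsub>Q.C (Suc n)\<^esub>"
    by (simp add: cochain_group_simps sub_mod_def)
  ultimately show ?thesis unfolding S.Z_iff Q.Z_iff by metis
qed

lemma Pi_lift:
  assumes "h \<in> carrier (Q.C n)" shows "\<exists>f\<in>carrier (C n). h = Pi n f"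
proof -
  have "\<forall>gs\<in>tuples G n. \<exists>t\<in>carrier T. h gs = \<pi> t"
    using Q.cochain_closed[OF assms] by (auto simp: quot_mod_def carrier_FactGroup)
  then obtain f where "\<And>gs. gs \<in> tuples G n \<Longrightarrow> f gs \<in> carrier T \<and> h gs = \<pi> (f gs)"
    by metis
  with assms have "(\<lambda>gs\<in>tuples G n. f gs) \<in> carrier (C n)" "h = Pi n (\<lambda>gs\<in>tuples G n. f gs)"
    by (auto simp: pull_def cochain_group_simps fun_eq_iff PiE_iff extensional_def)
  then show ?thesis by blast
qed

text \<open>Two pointwise choices: a representative in \<open>pT p T (r - m)\<close> for every
  value, then a root of that representative.\<close>

lemma sub_lift:
  assumes "h \<in> carrier (S.C n)"
  shows "\<exists>c\<in>carrier (C n). h = Pi n (c [^]\<^bsub>C n\<^esub> (p ^ (r - m)))"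
proof -
  have "\<forall>gs\<in>tuples G n. \<exists>t\<in>pT p T (r - m). h gs = \<pi> t"
    using S.cochain_closed[OF assms] by (auto simp: carrier_sub_mod)
  then obtain f where f: "\<And>gs. gs \<in> tuples G n \<Longrightarrow> f gs \<in> pT p T (r - m) \<and> h gs = \<pi> (f gs)"
    by metis
  let ?f = "\<lambda>gs\<in>tuples G n. f gs"
  have "?f \<in> carrier (C n)"
    using f subgroup.subset[OF subgroup_pT, of p "r - m"] by (auto simp: cochain_group_simps)
  moreover have "h = Pi n ?f"
    using assms f by (auto simp: pull_def cochain_group_simps fun_eq_iff PiE_iff extensional_def)
  ultimately show ?thesis using cochain_in_pT[of ?f n p "r - m"] f by force
qed

lemma Pi_pow_sub:
  assumes "c \<in> carrier (C n)"
  shows "Pi n (c [^]\<^bsub>C n\<^esub> (p ^ (r - m))) \<in> carrier (S.C n)"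
proof -
  have "(c [^]\<^bsub>C n\<^esub> (p ^ (r - m))) gs \<in> pT p T (r - m)" if "gs \<in> tuples G n" for gs
    using cochain_pow[OF assms that] cochain_closed[OF assms that] by (auto simp: pT_def)
  then show ?thesis by (auto simp: cochain_group_simps pull_def carrier_sub_mod)
qed

text \<open>Together with \<open>Pi_pow_mult\<close> this identifies the kernel of reduction on
  cochains with the \<open>p ^ r\<close>-fold multiples: the short exact sequence of coefficients at
  the level of cochains.\<close>

lemma Pi_eq_imp:
  assumes "f \<in> carrier (C n)" "f' \<in> carrier (C n)" "Pi n f = Pi n f'"
  shows "\<exists>e\<in>carrier (C n). f = e [^]\<^bsub>C n\<^esub> (p ^ r) \<otimes>\<^bsub>C n\<^esub> f'"
proof -
  interpret CS: comm_group "C n" by (rule comm_group_C)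
  let ?c = "f \<otimes>\<^bsub>C n\<^esub> inv\<^bsub>C n\<^esub> f'"
  have c: "?c \<in> carrier (C n)" using assms by simp
  have "?c gs \<in> pT p T r" if gs: "gs \<in> tuples G n" for gs
  proof -
    have fc: "f gs \<in> carrier T" "f' gs \<in> carrier T" using assms gs cochain_closed by blast+
    have "\<pi> (f gs) = \<pi> (f' gs)" using Pi_apply[OF gs] assms(3) by metis
    then obtain x where x: "x \<in> pT p T r" "f gs = x \<otimes>\<^bsub>T\<^esub> f' gs"
      using M.rcos_self[OF fc(1) subgroup_pT[of p r]] by (auto simp: r_coset_def)
    have "f gs = (?c \<otimes>\<^bsub>C n\<^esub> f') gs"
      by (rule fun_cong) (use assms in \<open>simp add: CS.m_assoc\<close>)
    also have "\<dots> = ?c gs \<otimes>\<^bsub>T\<^esub> f' gs" by (simp only: cochain_group_simps(3) restrict_apply' gs)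
    finally have "f gs = ?c gs \<otimes>\<^bsub>T\<^esub> f' gs" .
    then have "?c gs = x"
      using x fc cochain_closed[OF c gs] subgroup.mem_carrier[OF subgroup_pT x(1)] by simp
    then show ?thesis using x by simp
  qed
  then obtain e where "e \<in> carrier (C n)" "?c = e [^]\<^bsub>C n\<^esub> (p ^ r)"
    using cochain_in_pT[OF c] by blast
  moreover have "f = ?c \<otimes>\<^bsub>C n\<^esub> f'" using assms by (simp add: CS.m_assoc)
  ultimately show ?thesis by metis
qed

lemma Pi_pow_mult:
  assumes "f \<in> carrier (C n)" "e \<in> carrier (C n)"
  shows "Pi n (e [^]\<^bsub>C n\<^esub> (p ^ r) \<otimes>\<^bsub>C n\<^esub> f) = Pi n f"
proof -
  interpret CS: comm_group "C n" by (rule comm_group_C)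
  have "\<pi> ((e [^]\<^bsub>C n\<^esub> (p ^ r) \<otimes>\<^bsub>C n\<^esub> f) gs) = \<pi> (f gs)" if gs: "gs \<in> tuples G n" for gs
  proof -
    have fc: "f gs \<in> carrier T" "e gs \<in> carrier T" using assms gs cochain_closed by blast+
    then have "e gs [^]\<^bsub>T\<^esub> (p ^ r) \<in> pT p T r" by (auto simp: pT_def)
    moreover have "(e [^]\<^bsub>C n\<^esub> (p ^ r) \<otimes>\<^bsub>C n\<^esub> f) gs = e gs [^]\<^bsub>T\<^esub> (p ^ r) \<otimes>\<^bsub>T\<^esub> f gs"
      using gs cochain_pow[OF assms(2) gs] by (simp add: cochain_group_simps)
    ultimately have "(e [^]\<^bsub>C n\<^esub> (p ^ r) \<otimes>\<^bsub>C n\<^esub> f) gs \<in> \<pi> (f gs)" by (auto simp: r_coset_def)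
    then show ?thesis
      using M.repr_independence[OF _ fc(1) subgroup_pT] by simp
  qed
  then show ?thesis by (auto simp: pull_def fun_eq_iff)
qed

text \<open>Elements killed by a divisor of \<open>p ^ r\<close> are killed by \<open>p ^ r\<close>
  itself, so torsion-freeness applies to the pointwise differences.\<close>

lemma cochain_pow_cancel:
  assumes "x \<in> carrier (C n)" "y \<in> carrier (C n)" "x [^]\<^bsub>C n\<^esub> k = y [^]\<^bsub>C n\<^esub> k" "k dvd p ^ r"
  shows "x = y"
proof -
  interpret CS: comm_group "C n" by (rule comm_group_C)
  obtain l where l: "p ^ r = k * l" using assms(4) by (auto simp: dvd_def)
  have "x gs = y gs" if gs: "gs \<in> tuples G n" for gs
  proof -
    have c: "x gs \<in> carrier T" "y gs \<in> carrier T" using assms gs cochain_closed by blast+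
    have "x gs [^]\<^bsub>T\<^esub> k = y gs [^]\<^bsub>T\<^esub> k"
      using cochain_pow[OF assms(1) gs, of k] cochain_pow[OF assms(2) gs, of k] assms(3) by simp
    then have "x gs [^]\<^bsub>T\<^esub> (p ^ r) = y gs [^]\<^bsub>T\<^esub> (p ^ r)"
      using c by (simp add: l flip: M.nat_pow_pow)
    then have "(x gs \<otimes>\<^bsub>T\<^esub> inv\<^bsub>T\<^esub> y gs) [^]\<^bsub>T\<^esub> (p ^ r) = \<one>\<^bsub>T\<^esub>"
      using c by (simp add: M.nat_pow_distrib M.nat_pow_inv)
    then have "x gs \<otimes>\<^bsub>T\<^esub> inv\<^bsub>T\<^esub> y gs = \<one>\<^bsub>T\<^esub>" using c torsion_free by simp
    then show ?thesis using c M.inv_equality by fastforce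
  qed
  then show ?thesis
    using assms(1,2) unfolding cochain_group_simps by (metis PiE_ext)
qed

lemma d_pow: "c \<in> carrier (C n) \<Longrightarrow> d n (c [^]\<^bsub>C n\<^esub> (k::nat)) = d n c [^]\<^bsub>C (Suc n)\<^esub> k"
  using group_hom.hom_nat_pow[OF group_hom_d] .

text \<open>The reduction of \<open>d n f\<close> is the coboundary of the reduction of
  \<open>f\<close>. The quotient \<open>e\<close> represents the value of the connecting
  homomorphism.\<close>

lemma Pi_Z_iff:
  assumes "f \<in> carrier (C n)"
  shows "Pi n f \<in> Q.Z n \<longleftrightarrow> (\<exists>e\<in>carrier (C (Suc n)). d n f = e [^]\<^bsub>C (Suc n)\<^esub> (p ^ r))"
proof -
  interpret CS: comm_group "C (Suc n)" by (rule comm_group_C)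
  have "Pi n f \<in> Q.Z n \<longleftrightarrow> Pi (Suc n) (d n f) = Pi (Suc n) \<one>\<^bsub>C (Suc n)\<^esub>"
    using pro.cobound_pull[OF assms] pro.pull_closed[OF assms] by (simp add: Q.Z_iff pro.pull_one)
  also have "\<dots> \<longleftrightarrow> (\<exists>e\<in>carrier (C (Suc n)). d n f = e [^]\<^bsub>C (Suc n)\<^esub> (p ^ r))"
  proof
    assume "Pi (Suc n) (d n f) = Pi (Suc n) \<one>\<^bsub>C (Suc n)\<^esub>"
    then show "\<exists>e\<in>carrier (C (Suc n)). d n f = e [^]\<^bsub>C (Suc n)\<^esub> (p ^ r)"
      using Pi_eq_imp[OF cobound_closed[OF assms] CS.one_closed] by force
  next
    assume "\<exists>e\<in>carrier (C (Suc n)). d n f = e [^]\<^bsub>C (Suc n)\<^esub> (p ^ r)"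
    then show "Pi (Suc n) (d n f) = Pi (Suc n) \<one>\<^bsub>C (Suc n)\<^esub>"
      using Pi_pow_mult[OF CS.one_closed] by force
  qed
  finally show ?thesis .
qed

text \<open>The \<open>p ^ r\<close>-fold multiple of the coboundary of \<open>e\<close> is
  \<open>d d f = 0\<close>, and \<open>p ^ r\<close> can be cancelled.\<close>

lemma Z_of_pow_eq_cobound:
  assumes f: "f \<in> carrier (C n)" and e: "e \<in> carrier (C (Suc n))" and eq: "d n f = e [^]\<^bsub>C (Suc n)\<^esub> (p ^ r)"
  shows "e \<in> Z (Suc n)"
proof -
  interpret CS: comm_group "C (Suc (Suc n))" by (rule comm_group_C)
  have "d (Suc n) e [^]\<^bsub>C (Suc (Suc n))\<^esub> (p ^ r) = \<one>\<^bsub>C (Suc (Suc n))\<^esub>"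
    using cobound_cobound[OF f] d_pow[OF e] by (simp add: eq)
  then have "d (Suc n) e = \<one>\<^bsub>C (Suc (Suc n))\<^esub>"
    by (intro cochain_pow_cancel[OF cobound_closed[OF e] CS.one_closed, of "p ^ r"]) auto
  then show ?thesis using e by (simp add: Z_iff)
qed

lemma B_pow: "b \<in> B n \<Longrightarrow> b [^]\<^bsub>C n\<^esub> (k::nat) \<in> B n"
  by (induction k) (use subgroup.one_closed[OF subgroup_B] subgroup.m_closed[OF subgroup_B] in auto)

text \<open>The order of the group annihilates cohomology in positive degree and divides
  \<open>p ^ m\<close>. The free factor \<open>k\<close> makes room for the exponents
  \<open>r\<close> and \<open>r - m\<close>.\<close>

lemma Z_pow_in_B:
  assumes "e \<in> Z (Suc n)"
  shows "e [^]\<^bsub>C (Suc n)\<^esub> (p ^ m * k) \<in> B (Suc n)"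
proof -
  interpret CS: comm_group "C (Suc n)" by (rule comm_group_C)
  have e: "e \<in> carrier (C (Suc n))" "d (Suc n) e = \<one>\<^bsub>C (Suc (Suc n))\<^esub>" using assms by (auto simp: Z_iff)
  obtain l where l: "p ^ m = card (carrier G) * l" using card_dvd by (auto simp: dvd_def)
  have "e [^]\<^bsub>C (Suc n)\<^esub> card (carrier G) \<in> B (Suc n)"
    using pow_card_eq_cobound[OF finite_G e] sum_first_closed[OF e(1)] by simp
  then have "(e [^]\<^bsub>C (Suc n)\<^esub> card (carrier G)) [^]\<^bsub>C (Suc n)\<^esub> (l * k) \<in> B (Suc n)" by (rule B_pow)
  then show ?thesis using e(1) by (simp add: CS.nat_pow_pow l mult.assoc)
qed

lemma Pi_B_imp:
  assumes "h \<in> Q.B (Suc k)" shows "\<exists>b\<in>carrier (C k). h = Pi (Suc k) (d k b)"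
  using assms Pi_lift pro.cobound_pull by force

text \<open>Injectivity of the projection on classes. Additively, lifting gives
  \<open>c = p ^ r e + d b\<close>; since \<open>d c = 0\<close>, cancelling \<open>p ^ r\<close>
  makes \<open>e\<close> a cocycle, and then \<open>p ^ r e\<close> is a coboundary.\<close>

lemma Pi_injective:
  assumes c: "c \<in> Z (Suc k)" and Pc: "Pi (Suc k) c \<in> Q.B (Suc k)"
  shows "c \<in> B (Suc k)"
proof -
  interpret CS: comm_group "C (Suc k)" by (rule comm_group_C)
  interpret CSS: comm_group "C (Suc (Suc k))" by (rule comm_group_C)
  have cc: "c \<in> carrier (C (Suc k))" "d (Suc k) c = \<one>\<^bsub>C (Suc (Suc k))\<^esub>" using c by (auto simp: Z_iff)
  obtain b where b: "b \<in> carrier (C k)" "Pi (Suc k) c = Pi (Suc k) (d k b)"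
    using Pi_B_imp[OF Pc] by blast
  have db: "d k b \<in> carrier (C (Suc k))" using cobound_closed[OF b(1)] .
  obtain e where e: "e \<in> carrier (C (Suc k))" "c = e [^]\<^bsub>C (Suc k)\<^esub> (p ^ r) \<otimes>\<^bsub>C (Suc k)\<^esub> d k b"
    using Pi_eq_imp[OF cc(1) db b(2)] by blast
  have "\<one>\<^bsub>C (Suc (Suc k))\<^esub> = d (Suc k) (e [^]\<^bsub>C (Suc k)\<^esub> (p ^ r)) \<otimes>\<^bsub>C (Suc (Suc k))\<^esub> d (Suc k) (d k b)"
    using cc(2) unfolding e(2) using hom_mult[OF cobound_hom CS.nat_pow_closed[OF e(1)] db] by simp
  then have "d (Suc k) (e [^]\<^bsub>C (Suc k)\<^esub> (p ^ r)) = \<one>\<^bsub>C (Suc (Suc k))\<^esub>"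
    using cobound_cobound[OF b(1)] cobound_closed[OF CS.nat_pow_closed[OF e(1)]] by simp
  then have "d (Suc k) e [^]\<^bsub>C (Suc (Suc k))\<^esub> (p ^ r) = \<one>\<^bsub>C (Suc (Suc k))\<^esub>"
    using d_pow[OF e(1)] by simp
  then have "d (Suc k) e = \<one>\<^bsub>C (Suc (Suc k))\<^esub>"
    by (intro cochain_pow_cancel[OF cobound_closed[OF e(1)] CSS.one_closed, of "p ^ r"]) auto
  then have "e [^]\<^bsub>C (Suc k)\<^esub> (p ^ r) \<in> B (Suc k)"
    using Z_pow_in_B[of e k "p ^ (r - m)"] e(1) by (simp add: Z_iff flip: pow_split(1))
  moreover have "d k b \<in> B (Suc k)" using b by simp
  ultimately show ?thesis unfolding e(2) by (rule subgroup.m_closed[OF subgroup_B])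
qed

text \<open>The connecting homomorphism as a relation on all admissible lifts. The description
  operator avoids fixing a lift; that it denotes something is the content of
  \<open>conn_unique\<close> and \<open>conn_eq\<close>.\<close>

definition conn :: "nat \<Rightarrow> ('g list \<Rightarrow> 'a set) set \<Rightarrow> ('g list \<Rightarrow> 'a) set" where
  "conn n \<xi> = (THE \<eta>. \<exists>f e. f \<in> carrier (C n) \<and> e \<in> carrier (C (Suc n)) \<and>
     d n f = e [^]\<^bsub>C (Suc n)\<^esub> (p ^ r) \<and> \<xi> = Q.cls n (Pi n f) \<and> \<eta> = cls (Suc n) e)"

text \<open>Equal classes give, additively, \<open>f = p ^ r c + d b + f'\<close>. Applying
  \<open>d\<close> removes the middle term, and cancelling \<open>p ^ r\<close> leaves
  \<open>e = d c + e'\<close>.\<close>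

lemma conn_unique:
  assumes f: "f \<in> carrier (C (Suc k))" "e \<in> carrier (C (Suc (Suc k)))" "d (Suc k) f = e [^]\<^bsub>C (Suc (Suc k))\<^esub> (p ^ r)"
    and f': "f' \<in> carrier (C (Suc k))" "e' \<in> carrier (C (Suc (Suc k)))" "d (Suc k) f' = e' [^]\<^bsub>C (Suc (Suc k))\<^esub> (p ^ r)"
    and eq: "Q.cls (Suc k) (Pi (Suc k) f) = Q.cls (Suc k) (Pi (Suc k) f')"
  shows "cls (Suc (Suc k)) e = cls (Suc (Suc k)) e'"
proof -
  interpret CS: comm_group "C (Suc k)" by (rule comm_group_C)
  interpret CSS: comm_group "C (Suc (Suc k))" by (rule comm_group_C)
  have "Pi (Suc k) f \<in> Q.Z (Suc k)" "Pi (Suc k) f' \<in> Q.Z (Suc k)"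
    using Pi_Z_iff f f' by blast+
  then obtain h where h: "h \<in> Q.B (Suc k)" "Pi (Suc k) f = h \<otimes>\<^bsub>Q.C (Suc k)\<^esub> Pi (Suc k) f'"
    using eq Q.cls_eq_iff by blast
  obtain b where b: "b \<in> carrier (C k)" "h = Pi (Suc k) (d k b)"
    using Pi_B_imp[OF h(1)] by blast
  have db: "d k b \<in> carrier (C (Suc k))" using cobound_closed[OF b(1)] .
  have "Pi (Suc k) f = Pi (Suc k) (d k b \<otimes>\<^bsub>C (Suc k)\<^esub> f')"
    using hom_mult[OF pro.pull_hom db f'(1)] h b by simp
  then obtain c where c: "c \<in> carrier (C (Suc k))"
      "f = c [^]\<^bsub>C (Suc k)\<^esub> (p ^ r) \<otimes>\<^bsub>C (Suc k)\<^esub> (d k b \<otimes>\<^bsub>C (Suc k)\<^esub> f')"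
    using Pi_eq_imp[OF f(1) CS.m_closed[OF db f'(1)]] by blast
  have dc: "d (Suc k) c \<in> carrier (C (Suc (Suc k)))" using cobound_closed[OF c(1)] .
  have "e [^]\<^bsub>C (Suc (Suc k))\<^esub> (p ^ r) = d (Suc k) c [^]\<^bsub>C (Suc (Suc k))\<^esub> (p ^ r) \<otimes>\<^bsub>C (Suc (Suc k))\<^esub> e' [^]\<^bsub>C (Suc (Suc k))\<^esub> (p ^ r)"
    unfolding f(3)[symmetric] c(2)
    using hom_mult[OF cobound_hom CS.nat_pow_closed[OF c(1)] CS.m_closed[OF db f'(1)]]
      hom_mult[OF cobound_hom db f'(1)] d_pow[OF c(1)] cobound_cobound[OF b(1)] f'
    by simp
  also have "\<dots> = (d (Suc k) c \<otimes>\<^bsub>C (Suc (Suc k))\<^esub> e') [^]\<^bsub>C (Suc (Suc k))\<^esub> (p ^ r)"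
    using dc f' by (simp add: CSS.nat_pow_distrib)
  finally have "e = d (Suc k) c \<otimes>\<^bsub>C (Suc (Suc k))\<^esub> e'"
    by (rule cochain_pow_cancel[OF f(2) CSS.m_closed[OF dc f'(2)]]) simp
  moreover have "d (Suc k) c \<in> B (Suc (Suc k))" using c by simp
  ultimately show ?thesis
    using cls_eq_iff[OF Z_of_pow_eq_cobound[OF f] Z_of_pow_eq_cobound[OF f']] by blast
qed

text \<open>The bound on \<open>n\<close> enters through \<open>conn_unique\<close>, where a
  coboundary in degree \<open>n = Suc k\<close> is lifted to \<open>d k b\<close>.\<close>

lemma conn_eq:
  assumes f: "f \<in> carrier (C n)" "e \<in> carrier (C (Suc n))" "d n f = e [^]\<^bsub>C (Suc n)\<^esub> (p ^ r)"
    and n: "1 \<le> n"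
  shows "conn n (Q.cls n (Pi n f)) = cls (Suc n) e"
proof -
  obtain k where k: "n = Suc k" using n by (cases n) auto
  show ?thesis
    unfolding conn_def
  proof (rule the_equality)
    fix \<eta>
    assume "\<exists>f' e'. f' \<in> carrier (C n) \<and> e' \<in> carrier (C (Suc n)) \<and>
      d n f' = e' [^]\<^bsub>C (Suc n)\<^esub> (p ^ r) \<and> Q.cls n (Pi n f) = Q.cls n (Pi n f') \<and> \<eta> = cls (Suc n) e'"
    then obtain f' e' where "f' \<in> carrier (C n)" "e' \<in> carrier (C (Suc n))"
      "d n f' = e' [^]\<^bsub>C (Suc n)\<^esub> (p ^ r)" "Q.cls n (Pi n f) = Q.cls n (Pi n f')" "\<eta> = cls (Suc n) e'"
      by (elim exE conjE)
    then show "\<eta> = cls (Suc n) e"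
      using conn_unique[of f k e f' e'] f unfolding k by simp
  qed (intro exI[of _ f] exI[of _ e] conjI f refl)
qed

section \<open>Projection, inclusion and connecting homomorphism on cohomology groups\<close>

lemma pull_identity_eq: "(\<lambda>gs\<in>tuples G n. b (f gs)) = pull G n (\<lambda>x. x) b f"
  by (simp add: pull_def)

lemma pro_cls:
  assumes "c \<in> Z n" shows "pro G p T act r n (cls n c) = Q.cls n (Pi n c)"
  unfolding pro_def coh_map_def pull_identity_eq using pro.cls_pull_some[OF assms] .

lemma inc_cls:
  assumes "h \<in> S.Z n" shows "inc G p T act r m n (S.cls n h) = Q.cls n h"
proof -
  have "h \<in> carrier (S.C n)" using assms by (simp add: S.Z_iff)
  then show ?thesis
    using inc.cls_pull_some[OF assms] pull_inc[of h n]
    by (simp add: inc_def coh_map_def flip: pull_identity_eq)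
qed

lemma pro_hom: "pro G p T act r n \<in> hom (coh G T act n) (coh_quot G p T act r n)"
proof (rule homI)
  fix x y assume "x \<in> carrier (coh G T act n)" "y \<in> carrier (coh G T act n)"
  then obtain f f' where f: "f \<in> Z n" "x = cls n f" "f' \<in> Z n" "y = cls n f'"
    by (auto simp: carrier_coh)
  then have "f \<otimes>\<^bsub>C n\<^esub> f' \<in> Z n" using subgroup.m_closed[OF subgroup_Z] by blast
  moreover have "Pi n (f \<otimes>\<^bsub>C n\<^esub> f') = Pi n f \<otimes>\<^bsub>Q.C n\<^esub> Pi n f'"
    using f by (intro hom_mult[OF pro.pull_hom]) (auto simp: Z_iff)
  ultimately show "pro G p T act r n (x \<otimes>\<^bsub>coh G T act n\<^esub> y)
      = pro G p T act r n x \<otimes>\<^bsub>coh_quot G p T act r n\<^esub> pro G p T act r n y"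
    using f pro.pull_Z by (simp add: pro_cls Q.cls_mult coh_quot_def flip: cls_mult)
next
  fix x assume "x \<in> carrier (coh G T act n)"
  then obtain f where "f \<in> Z n" "x = cls n f" by (auto simp: carrier_coh)
  then show "pro G p T act r n x \<in> carrier (coh_quot G p T act r n)"
    using pro.pull_Z by (simp add: pro_cls coh_quot_def Q.carrier_coh)
qed

lemma inc_hom: "inc G p T act r m n \<in> hom (coh G (sub_mod p T r m) (act_set act) n) (coh_quot G p T act r n)"
proof (rule homI)
  fix x y assume "x \<in> carrier (coh G (sub_mod p T r m) (act_set act) n)"
    "y \<in> carrier (coh G (sub_mod p T r m) (act_set act) n)"
  then obtain f f' where f: "f \<in> S.Z n" "x = S.cls n f" "f' \<in> S.Z n" "y = S.cls n f'"
    by (auto simp: S.carrier_coh)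
  then have ff: "f \<otimes>\<^bsub>S.C n\<^esub> f' \<in> S.Z n" using subgroup.m_closed[OF S.subgroup_Z] by blast
  have "f \<in> Q.Z n" "f' \<in> Q.Z n" using f S_Z_iff by blast+
  moreover have "f \<otimes>\<^bsub>S.C n\<^esub> f' = f \<otimes>\<^bsub>Q.C n\<^esub> f'"
    by (simp add: cochain_group_simps sub_mod_def)
  ultimately show "inc G p T act r m n (x \<otimes>\<^bsub>coh G (sub_mod p T r m) (act_set act) n\<^esub> y)
      = inc G p T act r m n x \<otimes>\<^bsub>coh_quot G p T act r n\<^esub> inc G p T act r m n y"
    using f ff by (simp add: inc_cls Q.cls_mult coh_quot_def flip: S.cls_mult)
next
  fix x assume "x \<in> carrier (coh G (sub_mod p T r m) (act_set act) n)"
  then obtain f where f: "f \<in> S.Z n" "x = S.cls n f" by (auto simp: S.carrier_coh)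
  then have "f \<in> Q.Z n" using f S_Z_iff by blast
  then show "inc G p T act r m n x \<in> carrier (coh_quot G p T act r n)"
    using f by (simp add: inc_cls coh_quot_def Q.carrier_coh)
qed

lemma comm_group_coh_quot: "comm_group (coh_quot G p T act r n)"
  unfolding coh_quot_def by (rule Q.comm_group_coh)

lemma subgroup_pro_image: "subgroup (pro_image G p T act r n) (coh_quot G p T act r n)"
  unfolding pro_image_def using pro_hom comm_group.axioms(2)[OF comm_group_coh] comm_group.axioms(2)[OF comm_group_coh_quot]
  by (intro group_hom.img_is_subgroup) (simp add: group_hom_def group_hom_axioms_def)

lemma subgroup_inc_image: "subgroup (inc_image G p T act r m n) (coh_quot G p T act r n)"
  unfolding inc_image_def using inc_hom comm_group.axioms(2)[OF S.comm_group_coh] comm_group.axioms(2)[OF comm_group_coh_quot]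
  by (intro group_hom.img_is_subgroup) (simp add: group_hom_def group_hom_axioms_def)

lemma coh_quot_cases:
  assumes "\<xi> \<in> carrier (coh_quot G p T act r n)"
  obtains f e where "f \<in> carrier (C n)" "e \<in> carrier (C (Suc n))" "d n f = e [^]\<^bsub>C (Suc n)\<^esub> (p ^ r)"
    "Pi n f \<in> Q.Z n" "\<xi> = Q.cls n (Pi n f)"
proof -
  obtain h where h: "h \<in> Q.Z n" "\<xi> = Q.cls n h" using assms by (auto simp: coh_quot_def Q.carrier_coh)
  then obtain f where f: "f \<in> carrier (C n)" "h = Pi n f" using Pi_lift[of h n] by (auto simp: Q.Z_iff)
  then obtain e where "e \<in> carrier (C (Suc n))" "d n f = e [^]\<^bsub>C (Suc n)\<^esub> (p ^ r)"
    using Pi_Z_iff[OF f(1)] h(1) by blast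
  with f h that show ?thesis by blast
qed

lemma conn_hom:
  assumes n: "1 \<le> n"
  shows "conn n \<in> hom (coh_quot G p T act r n) (coh G T act (Suc n))"
proof (rule homI)
  interpret CS: comm_group "C n" by (rule comm_group_C)
  interpret CSS: comm_group "C (Suc n)" by (rule comm_group_C)
  fix x y assume "x \<in> carrier (coh_quot G p T act r n)" "y \<in> carrier (coh_quot G p T act r n)"
  then obtain f e f' e' where
    f: "f \<in> carrier (C n)" "e \<in> carrier (C (Suc n))" "d n f = e [^]\<^bsub>C (Suc n)\<^esub> (p ^ r)" "Pi n f \<in> Q.Z n" "x = Q.cls n (Pi n f)"
    and f': "f' \<in> carrier (C n)" "e' \<in> carrier (C (Suc n))" "d n f' = e' [^]\<^bsub>C (Suc n)\<^esub> (p ^ r)" "Pi n f' \<in> Q.Z n" "y = Q.cls n (Pi n f')"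
    by (elim coh_quot_cases)
  have "d n (f \<otimes>\<^bsub>C n\<^esub> f') = (e \<otimes>\<^bsub>C (Suc n)\<^esub> e') [^]\<^bsub>C (Suc n)\<^esub> (p ^ r)"
    using hom_mult[OF cobound_hom f(1) f'(1)] f f' by (simp add: CSS.nat_pow_distrib)
  then have "conn n (Q.cls n (Pi n (f \<otimes>\<^bsub>C n\<^esub> f'))) = cls (Suc n) (e \<otimes>\<^bsub>C (Suc n)\<^esub> e')"
    using f f' n by (intro conn_eq) auto
  moreover have "Q.cls n (Pi n (f \<otimes>\<^bsub>C n\<^esub> f')) = x \<otimes>\<^bsub>coh_quot G p T act r n\<^esub> y"
    using hom_mult[OF pro.pull_hom f(1) f'(1)] f f' by (simp add: coh_quot_def Q.cls_mult)
  moreover have "cls (Suc n) (e \<otimes>\<^bsub>C (Suc n)\<^esub> e') = cls (Suc n) e \<otimes>\<^bsub>coh G T act (Suc n)\<^esub> cls (Suc n) e'"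
    by (rule cls_mult[OF Z_of_pow_eq_cobound[OF f(1-3)] Z_of_pow_eq_cobound[OF f'(1-3)]])
  ultimately show "conn n (x \<otimes>\<^bsub>coh_quot G p T act r n\<^esub> y) = conn n x \<otimes>\<^bsub>coh G T act (Suc n)\<^esub> conn n y"
    using conn_eq[OF f(1-3) n] conn_eq[OF f'(1-3) n] f(5) f'(5) by simp
next
  fix x assume "x \<in> carrier (coh_quot G p T act r n)"
  then obtain f e where
    f: "f \<in> carrier (C n)" "e \<in> carrier (C (Suc n))" "d n f = e [^]\<^bsub>C (Suc n)\<^esub> (p ^ r)" "x = Q.cls n (Pi n f)"
    by (elim coh_quot_cases)
  then show "conn n x \<in> carrier (coh G T act (Suc n))"
    using conn_eq[OF f(1-3) n] Z_of_pow_eq_cobound[OF f(1-3)] by (simp add: carrier_coh)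
qed

section \<open>Exactness and the complement of the kernel\<close>

lemma conn_pro_image:
  assumes n: "1 \<le> n" and x: "x \<in> pro_image G p T act r n"
  shows "conn n x = \<one>\<^bsub>coh G T act (Suc n)\<^esub>"
proof -
  interpret CSS: comm_group "C (Suc n)" by (rule comm_group_C)
  obtain c where c: "c \<in> Z n" "x = Q.cls n (Pi n c)"
    using x pro_cls by (auto simp: pro_image_def carrier_coh)
  \<comment> \<open>The lift \<open>c\<close> is itself a cocycle, so the neutral cochain serves as
    \<open>e\<close>.\<close>
  then have "conn n x = cls (Suc n) \<one>\<^bsub>C (Suc n)\<^esub>"
    unfolding c(2) using n by (intro conn_eq) (auto simp: Z_iff)
  also have "\<dots> = \<one>\<^bsub>coh G T act (Suc n)\<^esub>"
    using cls_one_iff subgroup.one_closed[OF subgroup_Z] subgroup.one_closed[OF subgroup_B] by blast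
  finally show ?thesis .
qed

text \<open>If \<open>e = d c\<close>, then subtracting \<open>p ^ r c\<close> from the lift
  \<open>f\<close> yields a cocycle with the same reduction.\<close>

lemma pro_image_of_conn:
  assumes n: "1 \<le> n" and x: "x \<in> carrier (coh_quot G p T act r n)"
    and conn: "conn n x = \<one>\<^bsub>coh G T act (Suc n)\<^esub>"
  shows "x \<in> pro_image G p T act r n"
proof -
  interpret CS: comm_group "C n" by (rule comm_group_C)
  interpret CSS: comm_group "C (Suc n)" by (rule comm_group_C)
  obtain f e where
    f: "f \<in> carrier (C n)" "e \<in> carrier (C (Suc n))" "d n f = e [^]\<^bsub>C (Suc n)\<^esub> (p ^ r)" "x = Q.cls n (Pi n f)"
    using x by (elim coh_quot_cases)
  have "e \<in> B (Suc n)"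
    using conn conn_eq[OF f(1-3) n] f(4) cls_one_iff[OF Z_of_pow_eq_cobound[OF f(1-3)]] by simp
  then obtain c where c: "c \<in> carrier (C n)" "e = d n c" by auto
  define u where "u = f \<otimes>\<^bsub>C n\<^esub> inv\<^bsub>C n\<^esub> (c [^]\<^bsub>C n\<^esub> (p ^ r))"
  have u: "u \<in> carrier (C n)" using f c by (simp add: u_def)
  have fu: "f = c [^]\<^bsub>C n\<^esub> (p ^ r) \<otimes>\<^bsub>C n\<^esub> u" using f c by (simp add: u_def CS.mult_diff_cancel)
  have "d n f = d n f \<otimes>\<^bsub>C (Suc n)\<^esub> d n u"
    using hom_mult[OF cobound_hom CS.nat_pow_closed[OF c(1)] u, of "p ^ r"] d_pow[OF c(1)] f(3) c(2) fu by simp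
  then have "d n u = \<one>\<^bsub>C (Suc n)\<^esub>"
    using cobound_closed[OF u] cobound_closed[OF f(1)] by simp
  then have uZ: "u \<in> Z n" using u by (simp add: Z_iff)
  have "x = Q.cls n (Pi n u)" unfolding f(4) by (subst fu) (simp add: Pi_pow_mult[OF u c(1)])
  then show ?thesis using uZ pro_cls by (auto simp: pro_image_def carrier_coh)
qed

lemma conn_inc_image_surj:
  assumes n: "1 \<le> n" and y: "y \<in> carrier (coh G T act (Suc n))"
  shows "\<exists>x\<in>inc_image G p T act r m n. conn n x = y"
proof -
  obtain e where e: "e \<in> Z (Suc n)" "y = cls (Suc n) e" using y by (auto simp: carrier_coh)
  interpret CSS: comm_group "C (Suc n)" by (rule comm_group_C)
  have ec: "e \<in> carrier (C (Suc n))" using e by (simp add: Z_iff)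
  have "e [^]\<^bsub>C (Suc n)\<^esub> (p ^ m * 1) \<in> B (Suc n)" using Z_pow_in_B[OF e(1)] .
  then obtain c where c: "c \<in> carrier (C n)" "e [^]\<^bsub>C (Suc n)\<^esub> (p ^ m) = d n c" by auto
  interpret CS: comm_group "C n" by (rule comm_group_C)
  let ?f = "c [^]\<^bsub>C n\<^esub> (p ^ (r - m))"
  have fc: "?f \<in> carrier (C n)" using c by simp
  \<comment> \<open>The factors \<open>p ^ m\<close> from \<open>d c\<close> and
    \<open>p ^ (r - m)\<close> from \<open>?f\<close> combine to \<open>p ^ r\<close>, so
    \<open>?f\<close> is an admissible lift for \<open>e\<close>.\<close>
  have df: "d n ?f = e [^]\<^bsub>C (Suc n)\<^esub> (p ^ r)"
    using d_pow[OF c(1)] ec by (simp add: c(2)[symmetric] CSS.nat_pow_pow pow_split(1))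
  have "Pi n ?f \<in> Q.Z n" using Pi_Z_iff[OF fc] df ec by blast
  moreover have PS: "Pi n ?f \<in> carrier (S.C n)" using Pi_pow_sub[OF c(1)] .
  ultimately have SZ: "Pi n ?f \<in> S.Z n"
    using S_Z_iff by blast
  have "Q.cls n (Pi n ?f) \<in> inc_image G p T act r m n"
    unfolding inc_image_def S.carrier_coh using inc_cls[OF SZ] SZ by (metis image_eqI)
  then show ?thesis using conn_eq[OF fc ec df n] e(2) by blast
qed

lemma conn_inc_image_injective:
  assumes n: "1 \<le> n" and x: "x \<in> inc_image G p T act r m n"
    and conn: "conn n x = \<one>\<^bsub>coh G T act (Suc n)\<^esub>"
  shows "x = \<one>\<^bsub>coh_quot G p T act r n\<^esub>"
proof -
  obtain k where k: "n = Suc k" using n by (cases n) auto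
  interpret CS: comm_group "C n" by (rule comm_group_C)
  interpret CSS: comm_group "C (Suc n)" by (rule comm_group_C)
  obtain h where h: "h \<in> S.Z n" "x = Q.cls n h"
    using x inc_cls by (auto simp: inc_image_def S.carrier_coh)
  then obtain c where c: "c \<in> carrier (C n)" "h = Pi n (c [^]\<^bsub>C n\<^esub> (p ^ (r - m)))"
    using sub_lift by (auto simp: S.Z_iff)
  let ?f = "c [^]\<^bsub>C n\<^esub> (p ^ (r - m))"
  have fc: "?f \<in> carrier (C n)" using c by simp
  have hQ: "h \<in> Q.Z n" using h S_Z_iff by blast
  then obtain e where e: "e \<in> carrier (C (Suc n))" "d n ?f = e [^]\<^bsub>C (Suc n)\<^esub> (p ^ r)"
    using Pi_Z_iff[OF fc] c(2) by blast
  have "e \<in> B (Suc n)"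
    using conn conn_eq[OF fc e n] h(2) c(2) cls_one_iff[OF Z_of_pow_eq_cobound[OF fc e]] by simp
  then obtain b where b: "b \<in> carrier (C n)" "e = d n b" by auto
  \<comment> \<open>Torsion-freeness will cancel the common factor \<open>p ^ (r - m)\<close>, which
    leaves \<open>d c = p ^ m e\<close>.\<close>
  have "d n c [^]\<^bsub>C (Suc n)\<^esub> (p ^ (r - m)) = (e [^]\<^bsub>C (Suc n)\<^esub> (p ^ m)) [^]\<^bsub>C (Suc n)\<^esub> (p ^ (r - m))"
    using e d_pow[OF c(1)] by (simp add: CSS.nat_pow_pow pow_split(1))
  then have dc: "d n c = e [^]\<^bsub>C (Suc n)\<^esub> (p ^ m)"
    by (rule cochain_pow_cancel[OF cobound_closed[OF c(1)] CSS.nat_pow_closed[OF e(1)]])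
       (simp add: le_imp_power_dvd)
  \<comment> \<open>As \<open>e = d b\<close>, subtracting \<open>p ^ m b\<close> turns
    \<open>c\<close> into a cocycle.\<close>
  define u where "u = c \<otimes>\<^bsub>C n\<^esub> inv\<^bsub>C n\<^esub> (b [^]\<^bsub>C n\<^esub> (p ^ m))"
  have u: "u \<in> carrier (C n)" using b c by (simp add: u_def)
  have cu: "c = b [^]\<^bsub>C n\<^esub> (p ^ m) \<otimes>\<^bsub>C n\<^esub> u" using b c by (simp add: u_def CS.mult_diff_cancel)
  have "d n c = d n c \<otimes>\<^bsub>C (Suc n)\<^esub> d n u"
    using hom_mult[OF cobound_hom CS.nat_pow_closed[OF b(1)] u, of "p ^ m"] d_pow[OF b(1)] dc b(2) cu by simp
  then have "d n u = \<one>\<^bsub>C (Suc n)\<^esub>"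
    using cobound_closed[OF u] cobound_closed[OF c(1)] by simp
  then have "u \<in> Z (Suc k)" using u by (simp add: Z_iff k)
  \<comment> \<open>Here \<open>r - m\<close> is at least \<open>m\<close>, so the class of
    \<open>u\<close> is annihilated.\<close>
  then have us: "u [^]\<^bsub>C n\<^esub> (p ^ (r - m)) \<in> B n"
    using Z_pow_in_B[of u k "p ^ (r - 2 * m)"] by (simp add: k flip: pow_split(2))
  \<comment> \<open>The correction term contributes a \<open>p ^ r\<close>-fold multiple, which
    disappears under reduction.\<close>
  have "?f = b [^]\<^bsub>C n\<^esub> (p ^ r) \<otimes>\<^bsub>C n\<^esub> u [^]\<^bsub>C n\<^esub> (p ^ (r - m))"
    using b u by (subst cu) (simp add: CS.nat_pow_distrib CS.nat_pow_pow pow_split(1))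
  then have "h = Pi n (u [^]\<^bsub>C n\<^esub> (p ^ (r - m)))"
    using c(2) Pi_pow_mult[OF CS.nat_pow_closed[OF u] b(1)] by simp
  then have "h \<in> Q.B n" using pro.pull_B[OF us] by simp
  then show ?thesis using Q.cls_one_iff[OF hQ] h(2) by (simp add: coh_quot_def)
qed

lemma conn_iso:
  assumes n: "1 \<le> n"
  shows "conn n \<in> iso ((coh_quot G p T act r n)\<lparr>carrier := inc_image G p T act r m n\<rparr>) (coh G T act (Suc n))"
proof -
  interpret H: comm_group "coh_quot G p T act r n" by (rule comm_group_coh_quot)
  interpret K: comm_group "coh G T act (Suc n)" by (rule comm_group_coh)
  let ?I = "(coh_quot G p T act r n)\<lparr>carrier := inc_image G p T act r m n\<rparr>"
  interpret I: group ?I using H.subgroup_imp_group[OF subgroup_inc_image] .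
  have "conn n \<in> hom ?I (coh G T act (Suc n))"
    using conn_hom[OF n] subgroup.subset[OF subgroup_inc_image, of n] by (simp add: hom_def subset_iff Pi_iff)
  then interpret f: group_hom ?I "coh G T act (Suc n)" "conn n"
    by unfold_locales
  show ?thesis
    unfolding f.iso_iff using conn_inc_image_surj[OF n] conn_inc_image_injective[OF n] by auto
qed

text \<open>A subgroup that a homomorphism maps isomorphically onto its target is a complement of
  the kernel. Here the kernel of \<open>conn n\<close> is the image of \<open>pro\<close>.\<close>

lemma direct_sum:
  assumes n: "1 \<le> n"
  shows "internal_direct_sum (coh_quot G p T act r n) (pro_image G p T act r n) (inc_image G p T act r m n)"
  unfolding internal_direct_sum_def
proof (intro conjI subgroup_pro_image subgroup_inc_image)
  interpret H: comm_group "coh_quot G p T act r n" by (rule comm_group_coh_quot)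
  interpret K: comm_group "coh G T act (Suc n)" by (rule comm_group_coh)
  interpret f: group_hom "coh_quot G p T act r n" "coh G T act (Suc n)" "conn n"
    using conn_hom[OF n] by unfold_locales
  show "pro_image G p T act r n \<inter> inc_image G p T act r m n = {\<one>\<^bsub>coh_quot G p T act r n\<^esub>}"
    using conn_inc_image_injective[OF n] conn_pro_image[OF n]
      subgroup.one_closed[OF subgroup_pro_image] subgroup.one_closed[OF subgroup_inc_image] by auto
  show "pro_image G p T act r n <#>\<^bsub>coh_quot G p T act r n\<^esub> inc_image G p T act r m n
      = carrier (coh_quot G p T act r n)"
  proof (intro equalityI subsetI)
    fix x assume x: "x \<in> carrier (coh_quot G p T act r n)"
    then obtain y where y: "y \<in> inc_image G p T act r m n" "conn n y = conn n x"
      using conn_inc_image_surj[OF n f.hom_closed] by blast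
    then have yc: "y \<in> carrier (coh_quot G p T act r n)" using subgroup.mem_carrier[OF subgroup_inc_image] by blast
    let ?z = "x \<otimes>\<^bsub>coh_quot G p T act r n\<^esub> inv\<^bsub>coh_quot G p T act r n\<^esub> y"
    have "?z \<in> pro_image G p T act r n"
      using x yc y by (intro pro_image_of_conn[OF n]) auto
    moreover have "x = ?z \<otimes>\<^bsub>coh_quot G p T act r n\<^esub> y" using x yc by (simp add: H.m_assoc)
    ultimately show "x \<in> pro_image G p T act r n <#>\<^bsub>coh_quot G p T act r n\<^esub> inc_image G p T act r m n"
      using y(1) by (auto simp: set_mult_def)
  qed (use H.setmult_subset_G[OF subgroup.subset[OF subgroup_pro_image] subgroup.subset[OF subgroup_inc_image]] in blast)
qed

lemma pro_iso:
  assumes n: "1 \<le> n"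
  shows "pro G p T act r n \<in> iso (coh G T act n) ((coh_quot G p T act r n)\<lparr>carrier := pro_image G p T act r n\<rparr>)"
proof -
  obtain k where k: "n = Suc k" using n by (cases n) auto
  interpret H: comm_group "coh_quot G p T act r n" by (rule comm_group_coh_quot)
  interpret K: comm_group "coh G T act n" by (rule comm_group_coh)
  let ?I = "(coh_quot G p T act r n)\<lparr>carrier := pro_image G p T act r n\<rparr>"
  interpret I: group ?I using H.subgroup_imp_group[OF subgroup_pro_image] .
  have "pro G p T act r n \<in> hom (coh G T act n) ?I"
    using pro_hom[of n] by (auto simp: hom_def pro_image_def)
  then interpret f: group_hom "coh G T act n" ?I "pro G p T act r n"
    by unfold_locales
  have "x = \<one>\<^bsub>coh G T act n\<^esub>" if x: "x \<in> carrier (coh G T act n)"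
    and one: "pro G p T act r n x = \<one>\<^bsub>coh_quot G p T act r n\<^esub>" for x
  proof -
    obtain c where c: "c \<in> Z n" "x = cls n c" using x by (auto simp: carrier_coh)
    then have "Pi n c \<in> Q.B n"
      using one pro_cls[OF c(1)] Q.cls_one_iff[OF pro.pull_Z[OF c(1)]] by (simp add: coh_quot_def)
    then have "c \<in> B n" using Pi_injective c(1) unfolding k by blast
    then show ?thesis using cls_one_iff c by blast
  qed
  then show ?thesis
    unfolding f.iso_iff by (auto simp: pro_image_def)
qed

end

section \<open>Naturality\<close>

text \<open>The map \<open>bq\<close> on cosets is a parameter, constrained only on cosets of
  elements of \<open>T\<close>: in the applications it is the identity or an instance of
  \<open>act_set\<close>.\<close>

locale torsion_free_map =
  src: torsion_free_mod G T act p r m + tgt: torsion_free_mod H T' act' p r m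
  for G :: "('g, 'x) monoid_scheme" and T :: "('a, 'y) monoid_scheme" and act
    and H :: "('h, 'u) monoid_scheme" and T' :: "('b, 'v) monoid_scheme" and act' and p r m +
  fixes a :: "'h \<Rightarrow> 'g" and b :: "'a \<Rightarrow> 'b" and bq :: "'a set \<Rightarrow> 'b set"
  assumes group_map: "a \<in> hom H G"
    and module_map: "b \<in> hom T T'"
    and compatible: "\<lbrakk>h \<in> carrier H; t \<in> carrier T\<rbrakk> \<Longrightarrow> b (act t (a h)) = act' (b t) h"
    and quotient_map: "t \<in> carrier T \<Longrightarrow> bq (pT p T r #>\<^bsub>T\<^esub> t) = pT p T' r #>\<^bsub>T'\<^esub> b t"
begin

sublocale mod: compatible_pair G T act H T' act' a b
  by unfold_locales (rule group_map module_map compatible; assumption)+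

lemma quotient_hom: "bq \<in> hom (quot_mod p T r) (quot_mod p T' r)"
proof (rule homI)
  fix x y assume "x \<in> carrier (quot_mod p T r)" "y \<in> carrier (quot_mod p T r)"
  then obtain s t where st: "s \<in> carrier T" "x = pT p T r #>\<^bsub>T\<^esub> s" "t \<in> carrier T" "y = pT p T r #>\<^bsub>T\<^esub> t"
    by (auto simp: quot_mod_def carrier_FactGroup)
  then show "bq (x \<otimes>\<^bsub>quot_mod p T r\<^esub> y) = bq x \<otimes>\<^bsub>quot_mod p T' r\<^esub> bq y"
    using hom_mult[OF src.pi_hom st(1) st(3)] hom_mult[OF tgt.pi_hom, of "b s" "b t"]
      hom_mult[OF module_map st(1) st(3)] hom_in_carrier[OF module_map]
    by (simp add: quotient_map flip: hom_mult[OF src.pi_hom])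
next
  fix x assume "x \<in> carrier (quot_mod p T r)"
  then obtain s where "s \<in> carrier T" "x = pT p T r #>\<^bsub>T\<^esub> s" by (auto simp: quot_mod_def carrier_FactGroup)
  then show "bq x \<in> carrier (quot_mod p T' r)"
    using hom_in_carrier[OF tgt.pi_hom] hom_in_carrier[OF module_map] by (simp add: quotient_map)
qed

lemma quotient_compatible:
  assumes h: "h \<in> carrier H" and x: "x \<in> carrier (quot_mod p T r)"
  shows "bq (act_set act x (a h)) = act_set act' (bq x) h"
proof -
  obtain s where s: "s \<in> carrier T" "x = pT p T r #>\<^bsub>T\<^esub> s"
    using x by (auto simp: quot_mod_def carrier_FactGroup)
  have "a h \<in> carrier G" using hom_in_carrier[OF group_map h] .
  then show ?thesis
    using s h hom_in_carrier[OF module_map s(1)]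
    by (simp add: src.act_set_pi tgt.act_set_pi quotient_map compatible)
qed

sublocale quot: compatible_pair G "quot_mod p T r" "act_set act" H "quot_mod p T' r" "act_set act'" a bq
  by unfold_locales (rule group_map quotient_hom quotient_compatible; assumption)+

sublocale sub: compatible_pair G "sub_mod p T r m" "act_set act" H "sub_mod p T' r m" "act_set act'" a bq
proof unfold_locales
  show "bq \<in> hom (sub_mod p T r m) (sub_mod p T' r m)"
  proof (rule homI)
    fix x assume "x \<in> carrier (sub_mod p T r m)"
    then obtain t where t: "t \<in> carrier T" "x = pT p T r #>\<^bsub>T\<^esub> (t [^]\<^bsub>T\<^esub> (p ^ (r - m)))"
      by (auto simp: src.carrier_sub_mod pT_def)
    \<comment> \<open>Homomorphisms preserve powers, so \<open>bq\<close> respects the submodules of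
      multiples of \<open>p ^ (r - m)\<close>.\<close>
    then have "bq x = pT p T' r #>\<^bsub>T'\<^esub> (b t [^]\<^bsub>T'\<^esub> (p ^ (r - m)))"
      using hom_nat_pow[OF module_map t(1)] by (simp add: quotient_map)
    then show "bq x \<in> carrier (sub_mod p T' r m)"
      using hom_in_carrier[OF module_map t(1)] by (auto simp: tgt.carrier_sub_mod pT_def)
  next
    fix x y assume "x \<in> carrier (sub_mod p T r m)" "y \<in> carrier (sub_mod p T r m)"
    then have "bq (x \<otimes>\<^bsub>quot_mod p T r\<^esub> y) = bq x \<otimes>\<^bsub>quot_mod p T' r\<^esub> bq y"
      using src.sub_mod_subset by (intro hom_mult[OF quotient_hom]) auto
    then show "bq (x \<otimes>\<^bsub>sub_mod p T r m\<^esub> y) = bq x \<otimes>\<^bsub>sub_mod p T' r m\<^esub> bq y"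
      by (simp add: sub_mod_def)
  qed
qed (use group_map quotient_compatible src.sub_mod_subset in auto)

text \<open>The Hilbert choice is kept so that \<open>coh_res\<close> and \<open>coh_act\<close>
  unfold to precisely this form.\<close>

abbreviation res where
  "res k x \<equiv> tgt.cls k (pull H k a b (SOME c. c \<in> x))"
abbreviation res_quot where
  "res_quot k x \<equiv> tgt.Q.cls k (pull H k a bq (SOME c. c \<in> x))"

lemma pull_Pi:
  assumes "f \<in> carrier (src.C n)"
  shows "pull H n a bq (src.Pi n f) = tgt.Pi n (pull H n a b f)"
  using mod.map_tuples src.cochain_closed[OF assms] quotient_map
  by (auto simp: pull_def fun_eq_iff)

lemma res_closed: "y \<in> carrier (coh G T act n) \<Longrightarrow> res n y \<in> carrier (coh H T' act' n)"
  using mod.pull_Z src.some_cls by (auto simp: src.carrier_coh tgt.carrier_coh)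

lemma res_quot_pro:
  assumes "y \<in> carrier (coh G T act n)"
  shows "res_quot n (pro G p T act r n y) = pro H p T' act' r n (res n y)"
proof -
  obtain c where c: "c \<in> src.Z n" "y = src.cls n c" using assms by (auto simp: src.carrier_coh)
  then have "c \<in> carrier (src.C n)" by (simp add: src.Z_iff)
  with c show ?thesis
    using src.pro_cls[OF c(1)] quot.cls_pull_some[OF src.pro.pull_Z[OF c(1)]]
      mod.cls_pull_some[OF c(1)] tgt.pro_cls[OF mod.pull_Z[OF c(1)]] pull_Pi by simp
qed

lemma res_quot_pro_image:
  "x \<in> pro_image G p T act r n \<Longrightarrow> res_quot n x \<in> pro_image H p T' act' r n"
  using res_quot_pro res_closed by (auto simp: pro_image_def)

lemma res_quot_inc_image:
  assumes "x \<in> inc_image G p T act r m n"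
  shows "res_quot n x \<in> inc_image H p T' act' r m n"
proof -
  obtain h where h: "h \<in> src.S.Z n" "x = src.Q.cls n h"
    using assms src.inc_cls by (auto simp: inc_image_def src.S.carrier_coh)
  have hQ: "h \<in> src.Q.Z n" using h src.S_Z_iff by blast
  have hZ: "pull H n a bq h \<in> tgt.S.Z n" using sub.pull_Z[OF h(1)] .
  have "res_quot n x = inc H p T' act' r m n (tgt.S.cls n (pull H n a bq h))"
    using quot.cls_pull_some[OF hQ] tgt.inc_cls[OF hZ] h(2) by simp
  then show ?thesis using hZ unfolding inc_image_def tgt.S.carrier_coh by blast
qed

text \<open>Pulling back preserves coboundaries and powers, so an admissible pair \<open>f\<close>,
  \<open>e\<close> for \<open>x\<close> pulls back to an admissible pair for
  \<open>res_quot n x\<close>.\<close>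

lemma conn_res_quot:
  assumes x: "x \<in> carrier (coh_quot G p T act r n)" and n: "1 \<le> n"
  shows "tgt.conn n (res_quot n x) = res (Suc n) (src.conn n x)"
proof -
  obtain f e where f: "f \<in> carrier (src.C n)" "e \<in> carrier (src.C (Suc n))"
    "src.d n f = e [^]\<^bsub>src.C (Suc n)\<^esub> (p ^ r)" "src.Pi n f \<in> src.Q.Z n" "x = src.Q.cls n (src.Pi n f)"
    using x by (elim src.coh_quot_cases)
  have eZ: "e \<in> src.Z (Suc n)" using src.Z_of_pow_eq_cobound[OF f(1-3)] .
  have "tgt.d n (pull H n a b f) = pull H (Suc n) a b e [^]\<^bsub>tgt.C (Suc n)\<^esub> (p ^ r)"
    using mod.cobound_pull[OF f(1)] f(3)
      hom_nat_pow[OF mod.pull_hom f(2) comm_group.axioms(2)[OF src.comm_group_C] comm_group.axioms(2)[OF tgt.comm_group_C]]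
    by simp
  then have "tgt.conn n (tgt.Q.cls n (tgt.Pi n (pull H n a b f))) = tgt.cls (Suc n) (pull H (Suc n) a b e)"
    by (intro tgt.conn_eq mod.pull_closed f n)
  then show ?thesis
    using f(5) src.conn_eq[OF f(1-3) n] quot.cls_pull_some[OF f(4)] mod.cls_pull_some[OF eZ] pull_Pi[OF f(1)]
    by simp
qed

text \<open>Naturality of \<open>pro\<close> passes to its inverse because \<open>pro\<close> is
  injective on both sides.\<close>

lemma inv_pro_res_quot:
  assumes x: "x \<in> pro_image G p T act r n" and n: "1 \<le> n"
  shows "inv_into (carrier (coh H T' act' n)) (pro H p T' act' r n) (res_quot n x)
       = res n (inv_into (carrier (coh G T act n)) (pro G p T act r n) x)"
proof -
  obtain y where y: "y \<in> carrier (coh G T act n)" "x = pro G p T act r n y"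
    using x by (auto simp: pro_image_def)
  have "inj_on (pro G p T act r n) (carrier (coh G T act n))"
    "inj_on (pro H p T' act' r n) (carrier (coh H T' act' n))"
    using src.pro_iso[OF n] tgt.pro_iso[OF n] by (auto simp: iso_def bij_betw_def)
  then show ?thesis
    using y res_quot_pro[OF y(1)] res_closed[OF y(1)] by (simp add: inv_into_f_f)
qed

end

section \<open>Torsion-freeness of the \<open>p\<close>-adic lattice\<close>

text \<open>Multiplication by \<open>p ^ r\<close> loses \<open>r\<close> digits, so the assumption
  is read at level \<open>k + r\<close>: there \<open>p ^ k\<close> divides
  \<open>x (k + r)\<close>, whose residue modulo \<open>p ^ k\<close> is \<open>x k\<close>.\<close>

lemma padic_zero_of_mult_zero:
  fixes x :: "nat \<Rightarrow> int"
  assumes p: "0 < p" and x: "x \<in> carrier (padic_group p)"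
    and zero: "\<And>k. (int p ^ r * x k) mod int p ^ k = 0"
  shows "x k = 0"
proof -
  have step: "x (Suc k) mod int p ^ k = x k" "0 \<le> x k" "x k < int p ^ k" for k
    using x by (auto simp: padic_group_def)
  have "x (k + j) mod int p ^ k = x k" for j
  proof (induction j)
    case 0
    then show ?case using step by simp
  next
    case (Suc j)
    have "x (k + Suc j) mod int p ^ k = x (Suc (k + j)) mod int p ^ (k + j) mod int p ^ k"
      by (simp add: mod_mod_cancel le_imp_power_dvd)
    then show ?case using Suc step by simp
  qed
  from this[of r] have "x k = x (k + r) mod int p ^ k" by simp
  moreover have "int p ^ r * int p ^ k dvd int p ^ r * x (k + r)"
    using zero[of "k + r"] by (simp add: mod_eq_0_iff_dvd mult.commute flip: power_add)
  then have "int p ^ k dvd x (k + r)" using p by simp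
  ultimately show ?thesis by (simp add: mod_eq_0_iff_dvd)
qed

lemma torsion_free_of_iso_padic:
  fixes T :: "'a monoid"
  assumes T: "group T" and iso: "T \<cong> padic_vec_group p d" and p: "0 < p"
    and t: "t \<in> carrier T" and pow: "t [^]\<^bsub>T\<^esub> (p ^ r) = \<one>\<^bsub>T\<^esub>"
  shows "t = \<one>\<^bsub>T\<^esub>"
proof -
  interpret T: group T by fact
  obtain h where h: "h \<in> hom T (padic_vec_group p d)" and inj: "inj_on h (carrier T)"
    using iso by (auto simp: is_iso_def iso_def bij_betw_def)
  have hc: "h s \<in> (\<Pi>\<^sub>E i\<in>{..<d}. carrier (padic_group p))" if "s \<in> carrier T" for s
    using hom_in_carrier[OF h that] by (simp add: padic_vec_group_def)
  have hm: "h (s \<otimes>\<^bsub>T\<^esub> u) i k = (h s i k + h u i k) mod int p ^ k"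
    if "s \<in> carrier T" "u \<in> carrier T" "i < d" for s u i k
    using hom_mult[OF h that(1,2)] that(3) by (simp add: padic_vec_group_def padic_group_def)
  have bd: "0 \<le> h s i k \<and> h s i k < int p ^ k" if "s \<in> carrier T" "i < d" for s i k
    using hc[OF that(1)] that(2) by (auto simp: PiE_iff padic_group_def)
  \<comment> \<open>A residue equal to its own double is zero. Arguing with residues bypasses a
    proof that the target is a group.\<close>
  have h1: "h \<one>\<^bsub>T\<^esub> i k = 0" if "i < d" for i k
  proof -
    have "(h \<one>\<^bsub>T\<^esub> i k + h \<one>\<^bsub>T\<^esub> i k) mod int p ^ k = h \<one>\<^bsub>T\<^esub> i k mod int p ^ k"
      using hm[of "\<one>\<^bsub>T\<^esub>" "\<one>\<^bsub>T\<^esub>" i k] bd[of "\<one>\<^bsub>T\<^esub>" i k] that by simp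
    then have "h \<one>\<^bsub>T\<^esub> i k mod int p ^ k = 0"
      by (simp add: mod_eq_dvd_iff mod_eq_0_iff_dvd)
    then show ?thesis using bd[of "\<one>\<^bsub>T\<^esub>" i k] that by simp
  qed
  have hp: "h (t [^]\<^bsub>T\<^esub> (l::nat)) i k = (int l * h t i k) mod int p ^ k" if "i < d" for l i k
  proof (induction l)
    case 0
    then show ?case using h1[OF that] by simp
  next
    case (Suc l)
    then show ?case using hm[of "t [^]\<^bsub>T\<^esub> l" t i k] t that
      by (simp add: mod_simps algebra_simps)
  qed
  have "h t i k = 0" if "i < d" for i k
  proof (rule padic_zero_of_mult_zero[OF p])
    show "h t i \<in> carrier (padic_group p)" using hc[OF t] that by (auto simp: PiE_iff)
    show "(int p ^ r * h t i k) mod int p ^ k = 0" for k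
      using hp[OF that, of "p ^ r" k] h1[OF that] pow by simp
  qed
  then have "h t = h \<one>\<^bsub>T\<^esub>"
    using h1 by (intro PiE_ext[OF hc[OF t] hc[OF T.one_closed]]) auto
  then show ?thesis using inj t by (auto dest: inj_onD)
qed

text \<open>By Lagrange the order of \<open>Q\<close> divides \<open>p ^ m\<close>, and
  torsion-freeness concerns \<open>T\<close> alone; so one choice of \<open>p\<close>,
  \<open>r\<close> and \<open>m\<close> serves all subgroups.\<close>

lemma torsion_free_mod_subgroup:
  fixes P :: "'g monoid" and T :: "'a monoid"
  assumes p: "Factorial_Ring.prime p" and P: "group P" and card: "card (carrier P) = p ^ m"
    and mod: "right_module P T act" and iso: "T \<cong> padic_vec_group p d" and r: "2 * m \<le> r"
    and Q: "subgroup Q P"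
  shows "torsion_free_mod (P\<lparr>carrier := Q\<rparr>) T act p r m"
proof -
  interpret right_mod P T act using mod by (simp add: right_mod_iff)
  interpret Q: group "P\<lparr>carrier := Q\<rparr>" using G.subgroup_imp_group[OF Q] .
  have sub: "Q \<subseteq> carrier P" using subgroup.subset[OF Q] .
  have p0: "0 < p" using p prime_gt_0_nat by blast
  \<comment> \<open>Infinite sets have cardinality 0, so positivity of \<open>p ^ m\<close> yields
    finiteness.\<close>
  have "card (carrier P) > 0" using card p0 by simp
  then have fin: "finite (carrier P)" using card_ge_0_finite by blast
  have "card Q dvd p ^ m"
    using G.lagrange[OF Q] card by (metis dvd_triv_right order_def)
  then show ?thesis
    by unfold_locales
      (use sub fin finite_subset[OF sub] act_mult act_act r torsion_free_of_iso_padic[OF M.is_group iso p0]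
        in \<open>auto simp: subset_iff\<close>)
qed

section \<open>The splitting for all subgroups, with restriction and conjugation\<close>

theorem theorem4p1:
  fixes P :: "'g monoid" and T :: "'a monoid" and act :: "'a \<Rightarrow> 'g \<Rightarrow> 'a"
    and p m d n r :: nat
  assumes "Factorial_Ring.prime p"
    and "group P"
    and "card (carrier P) = p ^ m"
    and "right_module P T act"
    and "T \<cong> padic_vec_group p d"
    and "1 \<le> n"
    and "2 * m \<le> r"
  shows
    "internal_direct_sum (coh_quot P p T act r n)
        (pro_image P p T act r n) (inc_image P p T act r m n)
  \<and> (coh_quot P p T act r n)\<lparr>carrier := pro_image P p T act r n\<rparr> \<cong> coh P T act n
  \<and> (coh_quot P p T act r n)\<lparr>carrier := inc_image P p T act r m n\<rparr> \<cong> coh P T act (Suc n)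
  \<and> (\<exists>\<phi> \<psi>.
    (\<forall>Q. subgroup Q P \<longrightarrow>
        internal_direct_sum (coh_quot (P\<lparr>carrier := Q\<rparr>) p T act r n)
          (pro_image (P\<lparr>carrier := Q\<rparr>) p T act r n) (inc_image (P\<lparr>carrier := Q\<rparr>) p T act r m n)
      \<and> \<phi> Q \<in> iso ((coh_quot (P\<lparr>carrier := Q\<rparr>) p T act r n)
                     \<lparr>carrier := pro_image (P\<lparr>carrier := Q\<rparr>) p T act r n\<rparr>)
                   (coh (P\<lparr>carrier := Q\<rparr>) T act n)
      \<and> \<psi> Q \<in> iso ((coh_quot (P\<lparr>carrier := Q\<rparr>) p T act r n)
                     \<lparr>carrier := inc_image (P\<lparr>carrier := Q\<rparr>) p T act r m n\<rparr>)
                   (coh (P\<lparr>carrier := Q\<rparr>) T act (Suc n)))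
  \<and> (\<forall>Q Q'. subgroup Q P \<longrightarrow> subgroup Q' P \<longrightarrow> Q \<subseteq> Q' \<longrightarrow>
        (\<forall>x\<in>pro_image (P\<lparr>carrier := Q'\<rparr>) p T act r n.
           coh_res (P\<lparr>carrier := Q'\<rparr>) Q (quot_mod p T r) (act_set act) n x
             \<in> pro_image (P\<lparr>carrier := Q\<rparr>) p T act r n
         \<and> \<phi> Q (coh_res (P\<lparr>carrier := Q'\<rparr>) Q (quot_mod p T r) (act_set act) n x)
             = coh_res (P\<lparr>carrier := Q'\<rparr>) Q T act n (\<phi> Q' x))
      \<and> (\<forall>x\<in>inc_image (P\<lparr>carrier := Q'\<rparr>) p T act r m n.
           coh_res (P\<lparr>carrier := Q'\<rparr>) Q (quot_mod p T r) (act_set act) n x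
             \<in> inc_image (P\<lparr>carrier := Q\<rparr>) p T act r m n
         \<and> \<psi> Q (coh_res (P\<lparr>carrier := Q'\<rparr>) Q (quot_mod p T r) (act_set act) n x)
             = coh_res (P\<lparr>carrier := Q'\<rparr>) Q T act (Suc n) (\<psi> Q' x)))
  \<and> (\<forall>g\<in>carrier P.
        (\<forall>x\<in>pro_image P p T act r n.
           coh_act P (quot_mod p T r) (act_set act) n g x \<in> pro_image P p T act r n
         \<and> \<phi> (carrier P) (coh_act P (quot_mod p T r) (act_set act) n g x)
             = coh_act P T act n g (\<phi> (carrier P) x))
      \<and> (\<forall>x\<in>inc_image P p T act r m n.
           coh_act P (quot_mod p T r) (act_set act) n g x \<in> inc_image P p T act r m n
         \<and> \<psi> (carrier P) (coh_act P (quot_mod p T r) (act_set act) n g x)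
             = coh_act P T act (Suc n) g (\<psi> (carrier P) x))))"
proof -
  let ?P = "\<lambda>Q. P\<lparr>carrier := Q\<rparr>"
  \<comment> \<open>One isomorphism per subgroup and summand: the inverse of \<open>pro\<close> on
    its image, and the connecting homomorphism on the image of \<open>inc\<close>.\<close>
  define \<phi> where "\<phi> Q = inv_into (carrier (coh (?P Q) T act n)) (pro (?P Q) p T act r n)" for Q
  define \<psi> where "\<psi> Q = torsion_free_mod.conn (?P Q) T act p r n" for Q
  note tf = torsion_free_mod_subgroup[OF assms(1-5,7)]
  note n = assms(6)
  \<comment> \<open>The statements about \<open>P\<close> itself are the instance
    \<open>Q = carrier P\<close>.\<close>
  have PP: "?P (carrier P) = P" by simp
  have sP: "subgroup (carrier P) P" by (rule group.subgroup_self[OF assms(2)])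
  interpret P: torsion_free_mod P T act p r m using tf[OF sP] unfolding PP .
  have summands: "internal_direct_sum (coh_quot (?P Q) p T act r n)
          (pro_image (?P Q) p T act r n) (inc_image (?P Q) p T act r m n)
      \<and> \<phi> Q \<in> iso ((coh_quot (?P Q) p T act r n)\<lparr>carrier := pro_image (?P Q) p T act r n\<rparr>) (coh (?P Q) T act n)
      \<and> \<psi> Q \<in> iso ((coh_quot (?P Q) p T act r n)\<lparr>carrier := inc_image (?P Q) p T act r m n\<rparr>) (coh (?P Q) T act (Suc n))"
    if "subgroup Q P" for Q
  proof -
    interpret Q: torsion_free_mod "?P Q" T act p r m using tf[OF that] .
    interpret H: comm_group "coh (?P Q) T act n" by (rule Q.comm_group_coh)
    show ?thesis
      unfolding \<phi>_def \<psi>_def using Q.direct_sum[OF n] H.iso_set_sym[OF Q.pro_iso[OF n]] Q.conn_iso[OF n] by blast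
  qed
  have restriction: "(\<forall>x\<in>pro_image (?P Q') p T act r n.
           coh_res (?P Q') Q (quot_mod p T r) (act_set act) n x \<in> pro_image (?P Q) p T act r n
         \<and> \<phi> Q (coh_res (?P Q') Q (quot_mod p T r) (act_set act) n x) = coh_res (?P Q') Q T act n (\<phi> Q' x))
      \<and> (\<forall>x\<in>inc_image (?P Q') p T act r m n.
           coh_res (?P Q') Q (quot_mod p T r) (act_set act) n x \<in> inc_image (?P Q) p T act r m n
         \<and> \<psi> Q (coh_res (?P Q') Q (quot_mod p T r) (act_set act) n x) = coh_res (?P Q') Q T act (Suc n) (\<psi> Q' x))"
    if Q: "subgroup Q P" and Q': "subgroup Q' P" and sub: "Q \<subseteq> Q'" for Q Q'
  proof -
    interpret Q: torsion_free_mod "?P Q" T act p r m using tf[OF Q] .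
    interpret Q': torsion_free_mod "?P Q'" T act p r m using tf[OF Q'] .
    \<comment> \<open>Restriction is the pullback along the inclusion of \<open>Q\<close> into
      \<open>Q'\<close>, with identity maps on the coefficients.\<close>
    interpret f: torsion_free_map "?P Q'" T act "?P Q" T act p r m "\<lambda>x. x" "\<lambda>x. x" "\<lambda>x. x"
      by unfold_locales (use sub in \<open>auto simp: hom_def\<close>)
    \<comment> \<open>Generic in the coefficients, since it rewrites restriction both for
      \<open>T\<close> and for \<open>quot_mod p T r\<close>.\<close>
    have res: "coh_res (?P Q') Q M act' k x = coh_class (?P Q) M act' k (pull (?P Q) k (\<lambda>x. x) (\<lambda>x. x) (SOME c. c \<in> x))"
      for M :: "'c monoid" and act' k x
      by (simp add: coh_res_def pull_def)
    show ?thesis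
      unfolding res \<phi>_def \<psi>_def
      using f.res_quot_pro_image f.inv_pro_res_quot[OF _ n] f.res_quot_inc_image f.conn_res_quot[OF _ n]
        subgroup.mem_carrier[OF Q'.subgroup_inc_image] by blast
  qed
  have conjugation: "(\<forall>x\<in>pro_image P p T act r n.
           coh_act P (quot_mod p T r) (act_set act) n g x \<in> pro_image P p T act r n
         \<and> \<phi> (carrier P) (coh_act P (quot_mod p T r) (act_set act) n g x) = coh_act P T act n g (\<phi> (carrier P) x))
      \<and> (\<forall>x\<in>inc_image P p T act r m n.
           coh_act P (quot_mod p T r) (act_set act) n g x \<in> inc_image P p T act r m n
         \<and> \<psi> (carrier P) (coh_act P (quot_mod p T r) (act_set act) n g x)
             = coh_act P T act (Suc n) g (\<psi> (carrier P) x))"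
    if g: "g \<in> carrier P" for g
  proof -
    let ?h = "inv\<^bsub>P\<^esub> g"
    let ?a = "\<lambda>x. inv\<^bsub>P\<^esub> ?h \<otimes>\<^bsub>P\<^esub> x \<otimes>\<^bsub>P\<^esub> ?h"
    have hP: "?h \<in> carrier P" using g by simp
    \<comment> \<open>The action of \<open>g\<close> conjugates cochains with \<open>?h\<close>, the
      inverse of \<open>g\<close>, so the group map sends \<open>x\<close> to
      \<open>g x inv g\<close> and the module map is the action of \<open>g\<close>. The double
      inverses remain so that the maps agree literally with the unfolded
      \<open>coh_act\<close>.\<close>
    interpret f: torsion_free_map P T act P T act p r m ?a "\<lambda>t. act t (inv\<^bsub>P\<^esub> ?h)" "\<lambda>x. act_set act x (inv\<^bsub>P\<^esub> ?h)"
    proof unfold_locales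
      show "?a \<in> hom P P"
      proof (rule homI)
        fix x y assume xy: "x \<in> carrier P" "y \<in> carrier P"
        have "?a x \<otimes>\<^bsub>P\<^esub> ?a y = inv\<^bsub>P\<^esub> ?h \<otimes>\<^bsub>P\<^esub> x \<otimes>\<^bsub>P\<^esub> (?h \<otimes>\<^bsub>P\<^esub> inv\<^bsub>P\<^esub> ?h) \<otimes>\<^bsub>P\<^esub> y \<otimes>\<^bsub>P\<^esub> ?h"
          using hP xy by (simp only: P.G.m_assoc P.G.m_closed P.G.inv_closed)
        then show "?a (x \<otimes>\<^bsub>P\<^esub> y) = ?a x \<otimes>\<^bsub>P\<^esub> ?a y"
          using hP xy by (simp add: P.G.m_assoc)
      qed (use hP in simp)
      show "(\<lambda>t. act t (inv\<^bsub>P\<^esub> ?h)) \<in> hom T T" using P.act_hom hP by simp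
    next
      fix h t assume ht: "h \<in> carrier P" "t \<in> carrier T"
      \<comment> \<open>In the compatibility condition the trailing \<open>?h\<close> cancels
        against the module map, and both sides become the action of \<open>inv ?h\<close> times
        \<open>h\<close>.\<close>
      have "inv\<^bsub>P\<^esub> ?h \<otimes>\<^bsub>P\<^esub> h \<otimes>\<^bsub>P\<^esub> ?h \<otimes>\<^bsub>P\<^esub> inv\<^bsub>P\<^esub> ?h = inv\<^bsub>P\<^esub> ?h \<otimes>\<^bsub>P\<^esub> h"
        using hP ht by (simp add: P.G.m_assoc)
      then show "act (act t (?a h)) (inv\<^bsub>P\<^esub> ?h) = act (act t (inv\<^bsub>P\<^esub> ?h)) h"
        using ht hP by (simp add: P.act_act del: P.G.inv_inv)
    next
      fix t assume "t \<in> carrier T"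
      then show "act_set act (pT p T r #>\<^bsub>T\<^esub> t) (inv\<^bsub>P\<^esub> ?h) = pT p T r #>\<^bsub>T\<^esub> act t (inv\<^bsub>P\<^esub> ?h)"
        using hP by (intro P.act_set_pi) auto
    qed
    have ca: "coh_act P M act' k g x = coh_class P M act' k (pull P k ?a (\<lambda>t. act' t (inv\<^bsub>P\<^esub> ?h)) (SOME c. c \<in> x))"
      for M :: "'c monoid" and act' k x
      by (simp add: coh_act_def conj_cochain_def pull_def)
    show ?thesis
      unfolding ca \<phi>_def \<psi>_def PP
      using f.res_quot_pro_image f.inv_pro_res_quot[OF _ n] f.res_quot_inc_image f.conn_res_quot[OF _ n]
        subgroup.mem_carrier[OF P.subgroup_inc_image] by blast
  qed
  have "internal_direct_sum (coh_quot P p T act r n) (pro_image P p T act r n) (inc_image P p T act r m n)"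
    "(coh_quot P p T act r n)\<lparr>carrier := pro_image P p T act r n\<rparr> \<cong> coh P T act n"
    "(coh_quot P p T act r n)\<lparr>carrier := inc_image P p T act r m n\<rparr> \<cong> coh P T act (Suc n)"
    using summands[OF sP] unfolding PP by (auto intro: is_isoI)
  then show ?thesis
    by (rule conjI[OF _ conjI[OF _ conjI[OF _ exI[of _ \<phi>, OF exI[of _ \<psi>, OF conjI[OF _ conjI]]]]]])
       (intro allI impI, erule summands, (intro allI impI, rule restriction; assumption),
         (intro ballI, rule conjugation; assumption))
qed

end
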